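(* Let $A$ be an integral matrix with columns $A_1,\dots,A_n$ which is homogeneous, i.e. there is a nonzero vector $w$ with $w^TA_j=1$ for all $j$. Then $LP^+_i(A,b)=IP^+_i(A,b)$ for all $i\in\{1,\dots,n\}$ and all IP-feasible $b$ if and only if $P_A=\mathrm{conv}(A_1,\dots,A_n)$ is compressed.
   Context: $IP^+_i(A,b)$ is the optimal value of: maximize $x_i$ subject to $A\mathbf{x}=b$, $\mathbf{x}\ge0$, $\mathbf{x}$ integral; $LP^+_i(A,b)$ is the optimal value of the linear programming relaxation (drop integrality). $b$ is IP-feasible if $b=A\mathbf{x}$ for some nonnegative integral $\mathbf{x}$. $P_A$ is compressed with respect to the smallest lattice $\mathcal{L}$ containing $A_1,\dots,A_n$: for every ordering of the lattice points $P_A\cap\mathcal{L}$, the pulling triangulation (recursively: if the points are affinely independent, the single simplex; otherwise cone from the first point over the pulling triangulations, with induced ordering, of all facets not containing it) is unimodular, i.e. every simplex attains the minimal volume among all simplices spanned by lattice points of $P_A$. *)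

theory Defs
  imports "HOL-Analysis.Analysis" "HOL-Computational_Algebra.Group_Closure"
begin

definition LP_feasible :: "real^'n^'m \<Rightarrow> real^'m \<Rightarrow> (real^'n) set" where
  "LP_feasible A b = {x. A *v x = b \<and> (\<forall>j. 0 \<le> x $ j)}"

definition IP_feasible_points :: "real^'n^'m \<Rightarrow> real^'m \<Rightarrow> (real^'n) set" where
  "IP_feasible_points A b = {x \<in> LP_feasible A b. \<forall>j. x $ j \<in> \<int>}"

definition IP_feasible :: "real^'n^'m \<Rightarrow> real^'m \<Rightarrow> bool" where
  "IP_feasible A b \<longleftrightarrow> IP_feasible_points A b \<noteq> {}"

text \<open>Optimal values are extended reals, so that no junk value arises for an infeasible or
  unbounded program.\<close>

definition LP_max :: "'n \<Rightarrow> real^'n^'m \<Rightarrow> real^'m \<Rightarrow> ereal" where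
  "LP_max i A b = (SUP x \<in> LP_feasible A b. ereal (x $ i))"

definition IP_max :: "'n \<Rightarrow> real^'n^'m \<Rightarrow> real^'m \<Rightarrow> ereal" where
  "IP_max i A b = (SUP x \<in> IP_feasible_points A b. ereal (x $ i))"

text \<open>The volume of \<open>S\<close> inside its affine hull, i.e. its \<open>d\<close>-dimensional volume for
  \<open>d = aff_dim S\<close>. The set is thickened by the unit ball of the orthogonal complement of its
  direction space; by Fubini this multiplies the \<open>d\<close>-dimensional volume by the volume of the
  unit ball of dimension \<open>DIM('a) - d\<close>, which is divided out again.\<close>

definition rel_volume :: "'a::euclidean_space set \<Rightarrow> real" where
  "rel_volume S =
     measure lebesgue {x + y | x y. x \<in> S \<and> (\<forall>u\<in>S. \<forall>v\<in>S. y \<bullet> (u - v) = 0) \<and> norm y \<le> 1}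
     / unit_ball_vol (real_of_int (int DIM('a) - aff_dim S))"

lemma rel_volume_full_dim:
  fixes S :: "'a::euclidean_space set"
  assumes "aff_dim S = int DIM('a)"
  shows "rel_volume S = measure lebesgue S"
proof -
  have "y = 0" if y: "\<forall>u\<in>S. \<forall>v\<in>S. y \<bullet> (u - v) = 0" for y
  proof -
    have "S \<noteq> {}" using assms by auto
    then obtain a where a: "a \<in> S" by blast
    have "S \<subseteq> {x. y \<bullet> x = y \<bullet> a}"
    proof
      fix x assume "x \<in> S"
      then have "y \<bullet> (x - a) = 0" using y a by blast
      then show "x \<in> {x. y \<bullet> x = y \<bullet> a}" by (simp add: inner_diff_right)
    qed
    then have "affine hull S \<subseteq> {x. y \<bullet> x = y \<bullet> a}"
      by (simp add: affine_hyperplane hull_minimal)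
    moreover have "affine hull S = UNIV" using assms by (simp add: aff_dim_eq_full)
    ultimately have "y \<bullet> (a + y) = y \<bullet> a" by blast
    then show ?thesis by (simp add: inner_add_right)
  qed
  then have "{x + y | x y. x \<in> S \<and> (\<forall>u\<in>S. \<forall>v\<in>S. y \<bullet> (u - v) = 0) \<and> norm y \<le> 1} = S"
    by force
  then show ?thesis by (simp add: rel_volume_def assms unit_ball_vol_def)
qed

text \<open>The pulling triangulation of a point configuration, given as the list of its points in the
  chosen order. Each simplex is represented by its vertex set.\<close>

function pulling :: "'a::euclidean_space list \<Rightarrow> 'a set set" where
  "pulling xs =
     (if \<not> affine_dependent (set xs) then {set xs}
      else (\<Union>F \<in> {F. F facet_of (convex hull set xs) \<and> hd xs \<notin> F}.
              insert (hd xs) ` pulling (filter (\<lambda>x. x \<in> F) xs)))"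
  by pat_completeness auto
termination
proof (relation "Wellfounded.measure length")
  fix xs :: "'a list" and F
  assume "\<not> \<not> affine_dependent (set xs)" and F: "F \<in> {F. F facet_of (convex hull set xs) \<and> hd xs \<notin> F}"
  then have "xs \<noteq> []" by auto
  then show "(filter (\<lambda>x. x \<in> F) xs, xs) \<in> Wellfounded.measure length"
    using F length_filter_less[of "hd xs" xs "\<lambda>x. x \<in> F"] by simp
qed simp

declare pulling.simps [simp del]

definition lattice_simplex :: "'a::euclidean_space set \<Rightarrow> 'a set \<Rightarrow> 'a set \<Rightarrow> bool" where
  "lattice_simplex L P \<tau> \<longleftrightarrow> \<tau> \<subseteq> P \<inter> L \<and> \<not> affine_dependent \<tau> \<and> aff_dim \<tau> = aff_dim P"

definition compressed :: "'a::euclidean_space set \<Rightarrow> 'a set \<Rightarrow> bool" where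
  "compressed L P \<longleftrightarrow>
     (\<forall>xs. distinct xs \<and> set xs = P \<inter> L \<longrightarrow>
        (\<forall>\<sigma> \<in> pulling xs.
           is_arg_min (\<lambda>\<tau>. rel_volume (convex hull \<tau>)) (lattice_simplex L P) \<sigma>))"

text \<open>The orderings quantified over in \<open>compressed\<close> do exist for lattices generated by integral
  points: such a lattice has only finitely many points in a bounded set.\<close>

lemma finite_lattice_points:
  fixes S P :: "(real^'m) set"
  assumes "\<And>v k. v \<in> S \<Longrightarrow> v $ k \<in> \<int>" and "bounded P"
  shows "finite (P \<inter> group_closure S)"
proof -
  have int: "v $ k \<in> \<int>" if "v \<in> group_closure S" for v k
    using that by induction (use assms(1) in auto)
  obtain B where B: "\<And>x. x \<in> P \<Longrightarrow> norm x \<le> B" using assms(2) by (auto simp: bounded_iff)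
  define K where "K = {z \<in> \<int>. \<bar>z\<bar> \<le> B}"
  have "K \<subseteq> of_int ` {z. \<bar>real_of_int z\<bar> \<le> B}" unfolding K_def by (auto elim!: Ints_cases)
  also have "{z. \<bar>real_of_int z\<bar> \<le> B} \<subseteq> {-\<lfloor>B\<rfloor>..\<lfloor>B\<rfloor>}" by (auto; linarith)
  finally have "finite K" using finite_subset by blast
  then have "finite (vec_lambda ` (UNIV \<rightarrow>\<^sub>E K) :: (real^'m) set)"
    by (intro finite_imageI finite_PiE) auto
  moreover have "{v :: real^'m. \<forall>k. v $ k \<in> K} \<subseteq> vec_lambda ` (UNIV \<rightarrow>\<^sub>E K)"
  proof
    fix v :: "real^'m" assume "v \<in> {v. \<forall>k. v $ k \<in> K}"
    then have "($) v \<in> UNIV \<rightarrow>\<^sub>E K" by auto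
    then have "vec_lambda (($) v) \<in> vec_lambda ` (UNIV \<rightarrow>\<^sub>E K)" by (rule imageI)
    then show "v \<in> vec_lambda ` (UNIV \<rightarrow>\<^sub>E K)" by (simp only: vec_nth_inverse)
  qed
  ultimately have "finite {v :: real^'m. \<forall>k. v $ k \<in> K}" by (rule rev_finite_subset)
  moreover have "P \<inter> group_closure S \<subseteq> {v. \<forall>k. v $ k \<in> K}"
    unfolding K_def using int B by (auto intro: order_trans[OF component_le_norm_cart])
  ultimately show ?thesis by (rule rev_finite_subset)
qed

end

theory Submission
  imports Defs
begin

text \<open>
  Equality of the optimal values amounts to a rounding property of the columns \<open>S\<close>: whenever
  \<open>b\<close> lies in the semigroup generated by \<open>S\<close> and \<open>b - t s\<close> in the cone, \<open>b - \<lceil>t\<rceil> s\<close> lies in the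
  semigroup.

  If \<open>P\<close> is compressed, pull first one and then another of two lattice points \<open>p\<close>, \<open>q\<close> off a facet
  \<open>F\<close>, keeping the order of the other points. The pyramids over the same simplex of \<open>F\<close> with apexes
  \<open>p\<close> and \<open>q\<close> have equal volume, so \<open>p\<close> and \<open>q\<close> have the same distance from \<open>F\<close>. Hence every facet
  functional takes only two values on \<open>S\<close>, and rounding \<open>t\<close> up does not violate any facet inequality
  of the cone; repeatedly subtracting elements of \<open>S\<close> shows that lattice points of the cone lie in the
  semigroup.

  Conversely, the rounding property forces \<open>P\<close> to contain no lattice points besides \<open>S\<close>, passes to
  faces, and shows that \<open>S\<close> lies in the group generated by the points of a facet and any single point
  \<open>h\<close> off it: write \<open>s = k h + z\<close> with \<open>z\<close> in the span of the facet, move \<open>z\<close> into the cone of the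
  facet by adding an element of its semigroup, and round \<open>k\<close>. By induction every simplex of a pulling
  triangulation generates the lattice, so that every other lattice simplex has a nonzero integral
  multiple of its volume.
\<close>

section \<open>Cones, semigroups and the rounding property\<close>

text \<open>The convex cone generated by \<open>S\<close>. The inductive form lets proofs strip off
  one scaled generator at a time, without handling families of coefficients.\<close>

inductive_set nonneg_hull :: "'a::real_vector set \<Rightarrow> 'a set" for S where
  zero: "0 \<in> nonneg_hull S"
| step: "v \<in> nonneg_hull S \<Longrightarrow> s \<in> S \<Longrightarrow> 0 \<le> r \<Longrightarrow> v + r *\<^sub>R s \<in> nonneg_hull S"

inductive_set semigroup_hull :: "'a::monoid_add set \<Rightarrow> 'a set" for S where
  zero: "0 \<in> semigroup_hull S"
| step: "v \<in> semigroup_hull S \<Longrightarrow> s \<in> S \<Longrightarrow> v + s \<in> semigroup_hull S"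

lemma nonneg_hull_add:
  assumes "u \<in> nonneg_hull S" "v \<in> nonneg_hull S"
  shows "u + v \<in> nonneg_hull S"
  using assms(2)
proof induction
  case (step v s r)
  then show ?case using nonneg_hull.step[of "u + v" S s r] by (simp add: add.assoc)
qed (use assms(1) in simp)

lemma nonneg_hull_scaleR:
  assumes "v \<in> nonneg_hull S" "0 \<le> c"
  shows "c *\<^sub>R v \<in> nonneg_hull S"
  using assms(1)
proof induction
  case (step v s r)
  then show ?case
    using nonneg_hull.step[of "c *\<^sub>R v" S s "c * r"] assms(2) by (simp add: scaleR_add_right)
qed (simp add: nonneg_hull.zero)

lemma nonneg_hull_base: "s \<in> S \<Longrightarrow> s \<in> nonneg_hull S"
  using nonneg_hull.step[OF nonneg_hull.zero, of s S 1] by simp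

lemma nonneg_hull_sum: "(\<And>i. i \<in> I \<Longrightarrow> f i \<in> nonneg_hull S) \<Longrightarrow> sum f I \<in> nonneg_hull S"
  by (induction I rule: infinite_finite_induct)
    (auto intro: nonneg_hull.zero nonneg_hull_add)

lemma nonneg_hull_mono: "v \<in> nonneg_hull S \<Longrightarrow> S \<subseteq> T \<Longrightarrow> v \<in> nonneg_hull T"
  by (induction rule: nonneg_hull.induct) (auto intro: nonneg_hull.intros)

lemma semigroup_hull_add:
  assumes "u \<in> semigroup_hull S" "v \<in> semigroup_hull S"
  shows "u + v \<in> semigroup_hull S"
  using assms(2)
proof induction
  case (step v s)
  then show ?case using semigroup_hull.step[of "u + v" S s] by (simp add: add.assoc)
qed (use assms(1) in simp)

lemma semigroup_hull_scaleR_nat: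
  fixes v :: "'a::real_vector"
  shows "v \<in> semigroup_hull S \<Longrightarrow> of_nat n *\<^sub>R v \<in> semigroup_hull S"
  by (induction n) (auto simp: scaleR_add_left intro: semigroup_hull.zero semigroup_hull_add)

lemma semigroup_hull_base: "s \<in> S \<Longrightarrow> s \<in> semigroup_hull S"
  using semigroup_hull.step[OF semigroup_hull.zero, of s S] by simp

lemma semigroup_hull_sum:
  fixes f :: "'i \<Rightarrow> 'a::comm_monoid_add"
  shows "(\<And>i. i \<in> I \<Longrightarrow> f i \<in> semigroup_hull S) \<Longrightarrow> sum f I \<in> semigroup_hull S"
  by (induction I rule: infinite_finite_induct)
    (auto intro: semigroup_hull.zero semigroup_hull_add)

lemma semigroup_hull_mono: "v \<in> semigroup_hull S \<Longrightarrow> S \<subseteq> T \<Longrightarrow> v \<in> semigroup_hull T"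
  by (induction rule: semigroup_hull.induct) (auto intro: semigroup_hull.intros)

lemma semigroup_hull_subset_nonneg_hull: "v \<in> semigroup_hull S \<Longrightarrow> v \<in> nonneg_hull S"
  by (induction rule: semigroup_hull.induct)
    (auto intro: nonneg_hull.zero nonneg_hull_base nonneg_hull_add)

lemma group_closure_mono: "v \<in> group_closure S \<Longrightarrow> S \<subseteq> T \<Longrightarrow> v \<in> group_closure T"
  by (induction rule: group_closure.induct) (auto intro: group_closure.intros)

lemma semigroup_hull_subset_group_closure:
  "v \<in> semigroup_hull S \<Longrightarrow> v \<in> group_closure S"
  by (induction rule: semigroup_hull.induct)
    (auto intro: group_closure.base group_closure_add)

lemma group_closure_subset:
  assumes "v \<in> group_closure S" "S \<subseteq> group_closure T"
  shows "v \<in> group_closure T"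
  using assms(1)
  by induction (use assms(2) in \<open>auto intro: group_closure.diff\<close>)

lemma group_closure_scaleR_int:
  fixes v :: "'a::real_vector"
  assumes "v \<in> group_closure S"
  shows "of_int k *\<^sub>R v \<in> group_closure S"
proof -
  have nat: "of_nat n *\<^sub>R v \<in> group_closure S" for n
    by (induction n) (use assms in \<open>auto simp: scaleR_add_left intro: group_closure_add\<close>)
  show ?thesis
  proof (cases "k \<ge> 0")
    case True
    then show ?thesis using nat[of "nat k"] by simp
  next
    case False
    then have "- (of_int k *\<^sub>R v) \<in> group_closure S" using nat[of "nat (-k)"] by simp
    then show ?thesis by (simp only: group_closure_minus_iff)
  qed
qed

lemma group_closure_subset_span: "v \<in> group_closure S \<Longrightarrow> v \<in> span S"
  by (induction rule: group_closure.induct) (auto intro: span_base span_0 span_diff)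

text \<open>Differences of semigroup elements are closed under subtraction because
  \<open>(a - b) - (c - d) = (a + d) - (b + c)\<close>. This puts lattice points into the shape that
  \<open>rounding_normal\<close> expects.\<close>

lemma group_closure_eq_semigroup_diff:
  assumes "v \<in> group_closure S"
  obtains a b where "a \<in> semigroup_hull S" "b \<in> semigroup_hull S" "v = a - b"
proof -
  have "\<exists>a\<in>semigroup_hull S. \<exists>b\<in>semigroup_hull S. v = a - b"
    using assms
  proof induction
    case (base s)
    then show ?case
      using semigroup_hull.zero[of S] semigroup_hull_base[of s S] by (force intro: bexI[of _ s])
  next
    case (diff s t)
    then obtain a b c d where "a \<in> semigroup_hull S" "b \<in> semigroup_hull S"
      "c \<in> semigroup_hull S" "d \<in> semigroup_hull S" "s = a - b" "t = c - d" by blast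
    then have "s - t = (a + d) - (b + c)" "a + d \<in> semigroup_hull S" "b + c \<in> semigroup_hull S"
      by (auto intro: semigroup_hull_add)
    then show ?case by blast
  qed
  then show ?thesis using that by blast
qed

lemma inner_nonneg_hull_nonneg:
  assumes "v \<in> nonneg_hull S" "\<And>s. s \<in> S \<Longrightarrow> 0 \<le> f \<bullet> s"
  shows "0 \<le> f \<bullet> v"
  using assms by (induction rule: nonneg_hull.induct) (auto simp: inner_add_right)

text \<open>A sum of terms on which \<open>f\<close> is nonnegative vanishes under \<open>f\<close>
  only if every term does, so no generator off the face can occur.\<close>

lemma semigroup_hull_face:
  assumes "v \<in> semigroup_hull S" "\<And>s. s \<in> S \<Longrightarrow> 0 \<le> f \<bullet> s" "f \<bullet> v = 0"
  shows "v \<in> semigroup_hull {s \<in> S. f \<bullet> s = 0}"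
  using assms(1,3)
proof induction
  case (step v s)
  have "0 \<le> f \<bullet> v" "0 \<le> f \<bullet> s"
    using step.hyps assms(2) inner_nonneg_hull_nonneg semigroup_hull_subset_nonneg_hull by blast+
  then have "f \<bullet> v = 0" "f \<bullet> s = 0" using step.prems by (auto simp: inner_add_right)
  then show ?case using step by (auto intro: semigroup_hull.step)
qed (rule semigroup_hull.zero)

text \<open>The height \<open>w\<close> adds up the coefficients of the generators, so at height
  zero all of them vanish: the cone is pointed.\<close>

lemma nonneg_hull_height_zero:
  assumes "v \<in> nonneg_hull S" "\<And>s. s \<in> S \<Longrightarrow> w \<bullet> s = 1" "w \<bullet> v = 0"
  shows "v = 0"
  using assms(1,3)
proof induction
  case (step v s r)
  have "0 \<le> w \<bullet> v" using inner_nonneg_hull_nonneg[of v S w] step assms(2) by auto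
  then have "w \<bullet> v = 0" "r = 0" using step assms(2)[of s] by (auto simp: inner_add_right)
  then show ?case using step by simp
qed simp

text \<open>On the semigroup the height counts the summands, so an element of height one is a single
  generator.\<close>

lemma semigroup_hull_height_one:
  assumes "v \<in> semigroup_hull S" "\<And>s. s \<in> S \<Longrightarrow> w \<bullet> s = 1" "w \<bullet> v = 1"
  shows "v \<in> S"
  using assms(1)
proof cases
  case zero
  then show ?thesis using assms(3) by simp
next
  case (step u s)
  then have "w \<bullet> u = 0" using assms(2,3) by (simp add: inner_add_right)
  then have "u = 0"
    using nonneg_hull_height_zero[OF semigroup_hull_subset_nonneg_hull] step assms(2) by blast
  then show ?thesis using step by simp
qed

lemma convex_hull_subset_nonneg_hull: "convex hull S \<subseteq> nonneg_hull S"
proof (rule hull_minimal)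
  show "S \<subseteq> nonneg_hull S" using nonneg_hull_base by blast
  show "convex (nonneg_hull S)"
    by (intro convexI nonneg_hull_add nonneg_hull_scaleR)
qed

text \<open>Stated for a set of generators instead of a matrix, so that it does not see repeated
  columns and can be passed on to the generators lying on a face.\<close>

definition rounding :: "'a::real_vector set \<Rightarrow> bool" where
  "rounding S \<longleftrightarrow> (\<forall>b\<in>semigroup_hull S. \<forall>s\<in>S. \<forall>t\<ge>0.
     b - t *\<^sub>R s \<in> nonneg_hull S \<longrightarrow> b - of_int \<lceil>t\<rceil> *\<^sub>R s \<in> semigroup_hull S)"

lemma roundingD:
  "rounding S \<Longrightarrow> b \<in> semigroup_hull S \<Longrightarrow> s \<in> S \<Longrightarrow> 0 \<le> t \<Longrightarrow> b - t *\<^sub>R s \<in> nonneg_hull S \<Longrightarrow>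
   b - of_int \<lceil>t\<rceil> *\<^sub>R s \<in> semigroup_hull S"
  unfolding rounding_def by blast

section \<open>The two programs in terms of the cone and the semigroup of the columns\<close>

lemma axis_component: "axis i a $ j = (if j = i then a else 0)"
  by (simp add: axis_def)

lemma nonneg_hull_columns:
  fixes A :: "real^'n^'m"
  shows "v \<in> nonneg_hull (columns A) \<longleftrightarrow> (\<exists>x. A *v x = v \<and> (\<forall>j. 0 \<le> x $ j))"
proof
  assume "v \<in> nonneg_hull (columns A)"
  then show "\<exists>x. A *v x = v \<and> (\<forall>j. 0 \<le> x $ j)"
  proof induction
    case zero
    show ?case by (intro exI[of _ 0]) simp
  next
    case (step v s r)
    then obtain x j where "A *v x = v" "\<forall>j. 0 \<le> x $ j" "s = column j A"
      by (auto simp: columns_def)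
    then show ?case
      using step.hyps
      by (intro exI[of _ "x + r *\<^sub>R axis j 1"])
        (auto simp: matrix_vector_right_distrib matrix_vector_mult_scaleR
          matrix_vector_mult_basis axis_component)
  qed
next
  assume "\<exists>x. A *v x = v \<and> (\<forall>j. 0 \<le> x $ j)"
  then obtain x where x: "A *v x = v" "\<forall>j. 0 \<le> x $ j" by blast
  have "v = (\<Sum>j\<in>UNIV. x $ j *\<^sub>R column j A)"
    using x(1) by (simp add: matrix_mult_sum scalar_mult_eq_scaleR)
  also have "\<dots> \<in> nonneg_hull (columns A)"
    using x(2) by (intro nonneg_hull_sum nonneg_hull_scaleR nonneg_hull_base) (auto simp: columns_def)
  finally show "v \<in> nonneg_hull (columns A)" .
qed

lemma semigroup_hull_columns:
  fixes A :: "real^'n^'m"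
  shows "v \<in> semigroup_hull (columns A) \<longleftrightarrow> (\<exists>x. A *v x = v \<and> (\<forall>j. 0 \<le> x $ j \<and> x $ j \<in> \<int>))"
proof
  assume "v \<in> semigroup_hull (columns A)"
  then show "\<exists>x. A *v x = v \<and> (\<forall>j. 0 \<le> x $ j \<and> x $ j \<in> \<int>)"
  proof induction
    case zero
    show ?case by (intro exI[of _ 0]) simp
  next
    case (step v s)
    then obtain x j where "A *v x = v" "\<forall>j. 0 \<le> x $ j \<and> x $ j \<in> \<int>" "s = column j A"
      by (auto simp: columns_def)
    then show ?case
      by (intro exI[of _ "x + axis j 1"])
        (auto simp: matrix_vector_right_distrib matrix_vector_mult_basis axis_component)
  qed
next
  assume "\<exists>x. A *v x = v \<and> (\<forall>j. 0 \<le> x $ j \<and> x $ j \<in> \<int>)"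
  then obtain x where x: "A *v x = v" "\<forall>j. 0 \<le> x $ j" "\<forall>j. x $ j \<in> \<int>" by blast
  have "x $ j *\<^sub>R column j A \<in> semigroup_hull (columns A)" for j
  proof -
    obtain n where "x $ j = of_nat n"
      using x(2,3) by (metis Nats_cases Nats_altdef2 mem_Collect_eq)
    then show ?thesis
      using semigroup_hull_scaleR_nat[OF semigroup_hull_base, of "column j A" "columns A" n]
      by (auto simp: columns_def)
  qed
  then have "(\<Sum>j\<in>UNIV. x $ j *\<^sub>R column j A) \<in> semigroup_hull (columns A)"
    by (rule semigroup_hull_sum)
  moreover have "v = (\<Sum>j\<in>UNIV. x $ j *\<^sub>R column j A)"
    using x(1) by (simp add: matrix_mult_sum scalar_mult_eq_scaleR)
  ultimately show "v \<in> semigroup_hull (columns A)" by simp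
qed

text \<open>Subtracting \<open>t\<close> from coordinate \<open>j\<close> turns a solution for
  \<open>b\<close> with \<open>t \<le> x $ j\<close> into a solution for \<open>b\<close> minus
  \<open>t\<close> times column \<open>j\<close>, and adding \<open>t\<close> goes back. So
  membership of such a difference in the cone or the semigroup tells which values of coordinate
  \<open>j\<close> the relaxation or the integer program can reach.\<close>

lemma LP_eq_IP_iff_rounding:
  fixes A :: "real^'n^'m"
  shows "(\<forall>i b. IP_feasible A b \<longrightarrow> LP_max i A b = IP_max i A b) \<longleftrightarrow> rounding (columns A)"
proof
  assume eq: "\<forall>i b. IP_feasible A b \<longrightarrow> LP_max i A b = IP_max i A b"
  show "rounding (columns A)"
    unfolding rounding_def
  proof (intro ballI allI impI)
    fix b s and t :: real
    assume b: "b \<in> semigroup_hull (columns A)" and s: "s \<in> columns A" and t: "0 \<le> t"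
      and bt: "b - t *\<^sub>R s \<in> nonneg_hull (columns A)"
    obtain j where j: "s = column j A" using s by (auto simp: columns_def)
    obtain y where y: "A *v y = b - t *\<^sub>R s" "\<forall>j. 0 \<le> y $ j"
      using bt nonneg_hull_columns by blast
    define x where "x = y + t *\<^sub>R axis j 1"
    have x: "x \<in> LP_feasible A b"
      using y t j by (auto simp: x_def LP_feasible_def matrix_vector_right_distrib
          matrix_vector_mult_scaleR matrix_vector_mult_basis axis_component)
    have xj: "t \<le> x $ j" using y by (simp add: x_def axis_component)
    have "IP_feasible A b"
      using b semigroup_hull_columns[of b A]
      by (auto simp: IP_feasible_def IP_feasible_points_def LP_feasible_def)
    then have "LP_max j A b = IP_max j A b" using eq by blast
    \<comment> \<open>The optima are suprema that are not known to be attained. The strict bound by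
      \<open>\<lceil>t\<rceil> - 1\<close> still yields an actual integral point above it, and
      integrality lifts its coordinate to at least \<open>\<lceil>t\<rceil>\<close>.\<close>
    moreover have "of_int (\<lceil>t\<rceil> - 1) < x $ j" using xj by linarith
    then have "ereal (of_int (\<lceil>t\<rceil> - 1)) < LP_max j A b"
      unfolding LP_max_def using x by (auto simp: less_SUP_iff)
    ultimately have "ereal (of_int (\<lceil>t\<rceil> - 1)) < IP_max j A b" by simp
    then obtain z where z: "z \<in> IP_feasible_points A b" "of_int (\<lceil>t\<rceil> - 1) < z $ j"
      unfolding IP_max_def less_SUP_iff by auto
    obtain k where k: "z $ j = of_int k" using z by (auto simp: IP_feasible_points_def elim: Ints_cases)
    have zj: "of_int \<lceil>t\<rceil> \<le> z $ j" using z(2) unfolding k of_int_less_iff of_int_le_iff by linarith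
    show "b - of_int \<lceil>t\<rceil> *\<^sub>R s \<in> semigroup_hull (columns A)"
      unfolding semigroup_hull_columns
      using z(1) zj j
      by (intro exI[of _ "z - of_int \<lceil>t\<rceil> *\<^sub>R axis j 1"])
        (auto simp: IP_feasible_points_def LP_feasible_def matrix_vector_mult_diff_distrib
          matrix_vector_mult_scaleR matrix_vector_mult_basis axis_component)
  qed
next
  assume round: "rounding (columns A)"
  show "\<forall>i b. IP_feasible A b \<longrightarrow> LP_max i A b = IP_max i A b"
  proof (intro allI impI antisym)
    fix i b
    assume "IP_feasible A b"
    then have b: "b \<in> semigroup_hull (columns A)"
      by (auto simp: semigroup_hull_columns IP_feasible_def IP_feasible_points_def LP_feasible_def)
    show "IP_max i A b \<le> LP_max i A b"
      unfolding IP_max_def LP_max_def by (rule SUP_subset_mono) (auto simp: IP_feasible_points_def)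
    show "LP_max i A b \<le> IP_max i A b"
      unfolding LP_max_def IP_max_def
    proof (rule SUP_mono)
      fix x assume x: "x \<in> LP_feasible A b"
      have "A *v (x - x $ i *\<^sub>R axis i 1) = b - x $ i *\<^sub>R column i A"
        "\<forall>j. 0 \<le> (x - x $ i *\<^sub>R axis i 1) $ j"
        using x by (auto simp: LP_feasible_def matrix_vector_mult_diff_distrib
          matrix_vector_mult_scaleR matrix_vector_mult_basis axis_component)
      then have "b - x $ i *\<^sub>R column i A \<in> nonneg_hull (columns A)"
        using nonneg_hull_columns by blast
      then have "b - of_int \<lceil>x $ i\<rceil> *\<^sub>R column i A \<in> semigroup_hull (columns A)"
        using roundingD[OF round b] x by (auto simp: LP_feasible_def columns_def)
      then obtain z where z: "A *v z = b - of_int \<lceil>x $ i\<rceil> *\<^sub>R column i A"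
        "\<forall>j. 0 \<le> z $ j \<and> z $ j \<in> \<int>"
        using semigroup_hull_columns by blast
      have xi: "0 \<le> x $ i" using x by (simp add: LP_feasible_def)
      define y where "y = z + of_int \<lceil>x $ i\<rceil> *\<^sub>R axis i 1"
      have "y \<in> IP_feasible_points A b"
        using z xi by (auto simp: y_def IP_feasible_points_def LP_feasible_def
            matrix_vector_right_distrib matrix_vector_mult_scaleR matrix_vector_mult_basis axis_component)
      moreover have "x $ i \<le> y $ i"
        using z(2)[rule_format, of i] unfolding y_def by (simp add: axis_component) linarith
      ultimately show "\<exists>y\<in>IP_feasible_points A b. ereal (x $ i) \<le> ereal (y $ i)" by auto
    qed
  qed
qed

section \<open>Facets and pulling\<close>

text \<open>Within its affine hull a polyhedron is an irredundant intersection of halfspaces, each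
  of which supports a facet; a point outside violates one of them.\<close>

lemma facet_separation:
  fixes P :: "'a::euclidean_space set"
  assumes "polyhedron P" "z \<in> affine hull P" "z \<notin> P"
  obtains a c where "P \<subseteq> {x. a \<bullet> x \<le> c}" "(P \<inter> {x. a \<bullet> x = c}) facet_of P" "c < a \<bullet> z"
proof -
  obtain H where H: "finite H" "P = affine hull P \<inter> \<Inter>H"
    "\<forall>h\<in>H. \<exists>a b. a \<noteq> 0 \<and> h = {x. a \<bullet> x \<le> b}"
    "\<forall>H'. H' \<subset> H \<longrightarrow> P \<subset> affine hull P \<inter> \<Inter>H'"
    using assms(1) unfolding polyhedron_Int_affine_minimal by blast
  then obtain a b where ab: "\<And>h. h \<in> H \<Longrightarrow> a h \<noteq> 0 \<and> h = {x. a h \<bullet> x \<le> b h}" by metis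
  obtain h where h: "h \<in> H" "z \<notin> h" using assms(2,3) H(2) by blast
  have "(P \<inter> {x. a h \<bullet> x = b h}) facet_of P"
    using facet_of_polyhedron_explicit[OF H(1,2) ab] H(4) h(1) by blast
  moreover have "P \<subseteq> h" using H(2) h(1) by blast
  ultimately show ?thesis using that[of "a h" "b h"] ab[OF h(1)] h(2) by fastforce
qed

lemma facet_hyperplane:
  fixes P :: "'a::euclidean_space set"
  assumes "polyhedron P" "F facet_of P"
  obtains a c where "P \<subseteq> {x. a \<bullet> x \<le> c}" "F = P \<inter> {x. a \<bullet> x = c}"
proof -
  have "F exposed_face_of P"
    using assms exposed_face_of_polyhedron facet_of_imp_face_of by blast
  then show ?thesis using that unfolding exposed_face_of_def by blast
qed

lemma bounded_ray_trivial:
  fixes v :: "'a::real_normed_vector"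
  assumes "bounded P" and ray: "\<And>r. 0 \<le> r \<Longrightarrow> p + r *\<^sub>R v \<in> P"
  shows "v = 0"
proof (rule ccontr)
  assume "v \<noteq> 0"
  obtain B where B: "\<forall>x\<in>P. norm x \<le> B" using assms(1) bounded_iff by blast
  \<comment> \<open>Chosen so that \<open>r *\<^sub>R v\<close> has norm
    \<open>B + norm p + 1\<close>, too long for both ends of the segment to lie in
    \<open>P\<close>.\<close>
  define r where "r = (B + norm p + 1) / norm v"
  have "p \<in> P" using ray[of 0] by simp
  then have "0 \<le> B" using B norm_ge_zero order_trans by blast
  then have r: "0 \<le> r" by (simp add: r_def)
  have "norm (r *\<^sub>R v) \<le> norm (p + r *\<^sub>R v) + norm p"
    by (metis add.commute add_diff_cancel_left' norm_triangle_ineq4)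
  also have "\<dots> \<le> B + norm p" using B ray[OF r] by auto
  finally show False using \<open>v \<noteq> 0\<close> r by (simp add: r_def)
qed

text \<open>If every facet contained \<open>p\<close>, every facet inequality would be tight at
  \<open>p\<close> and could not increase towards \<open>q\<close>. The ray from \<open>p\<close>
  through \<open>q\<close> would then never leave \<open>P\<close>, against boundedness.\<close>

lemma facet_avoiding_point:
  fixes P :: "'a::euclidean_space set"
  assumes "polytope P" "p \<in> P" "q \<in> P" "p \<noteq> q"
  obtains F where "F facet_of P" "p \<notin> F"
proof (rule ccontr)
  assume "\<not> thesis"
  then have all: "p \<in> F" if "F facet_of P" for F
    using that \<open>\<And>F. F facet_of P \<Longrightarrow> p \<notin> F \<Longrightarrow> thesis\<close> by blast
  have ray: "p + r *\<^sub>R (q - p) \<in> P" if "0 \<le> r" for r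
  proof (rule ccontr)
    assume out: "p + r *\<^sub>R (q - p) \<notin> P"
    have "p + r *\<^sub>R (q - p) = (1 - r) *\<^sub>R p + r *\<^sub>R q" by (simp add: algebra_simps)
    also have "\<dots> \<in> affine hull P"
      using assms by (intro mem_affine) (auto simp: hull_inc)
    finally obtain a c where a: "P \<subseteq> {x. a \<bullet> x \<le> c}" "(P \<inter> {x. a \<bullet> x = c}) facet_of P"
      "c < a \<bullet> (p + r *\<^sub>R (q - p))"
      using facet_separation[OF polytope_imp_polyhedron[OF assms(1)] _ out] by blast
    have "a \<bullet> p = c" using all[OF a(2)] by simp
    moreover have "a \<bullet> q \<le> c" using a(1) assms by blast
    ultimately have "r * (a \<bullet> (q - p)) \<le> 0"
      using that by (intro mult_nonneg_nonpos) (auto simp: inner_diff_right)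
    then show False using a(3) \<open>a \<bullet> p = c\<close> by (simp add: inner_add_right)
  qed
  have "q - p = 0" using bounded_ray_trivial[OF polytope_imp_bounded[OF assms(1)] ray] .
  then show False using assms(4) by simp
qed

text \<open>Connects the facets used by \<open>pulling\<close> with its recursive call: the points
  kept by the filter have the facet as their convex hull.\<close>

lemma face_eq_convex_hull_Int:
  fixes S :: "'a::euclidean_space set"
  assumes "finite S" "F face_of convex hull S"
  shows "F = convex hull (S \<inter> F)"
proof -
  obtain S' where S': "S' \<subseteq> S" "F = convex hull S'"
    using face_of_convex_hull_subset[OF finite_imp_compact[OF assms(1)] assms(2)] by blast
  then have "S' \<subseteq> S \<inter> F" using hull_subset by fast
  moreover have "convex hull (S \<inter> F) \<subseteq> F"
    using S'(2) by (metis convex_convex_hull hull_minimal inf_le2)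
  ultimately show ?thesis using S'(2) hull_mono by blast
qed

lemma pulling_subset: "\<sigma> \<in> pulling xs \<Longrightarrow> \<sigma> \<subseteq> set xs"
proof (induction xs arbitrary: \<sigma> rule: pulling.induct)
  case (1 xs)
  show ?case
  proof (cases "affine_dependent (set xs)")
    case True
    then have "hd xs \<in> set xs" by (cases xs) auto
    moreover obtain F \<tau> where "F facet_of (convex hull set xs)" "hd xs \<notin> F"
      "\<tau> \<in> pulling (filter (\<lambda>x. x \<in> F) xs)" "\<sigma> = insert (hd xs) \<tau>"
      using 1(2) True by (subst (asm) pulling.simps) auto
    ultimately show ?thesis using 1(1)[of F \<tau>] True by auto
  next
    case False
    then show ?thesis using 1(2) by (subst (asm) pulling.simps) auto
  qed
qed

text \<open>An affinely dependent set has a point besides the first one, so some facet avoids the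
  first point and the recursion has a branch to follow.\<close>

lemma pulling_nonempty: "pulling xs \<noteq> {}"
proof (induction xs rule: pulling.induct)
  case (1 xs)
  show ?case
  proof (cases "affine_dependent (set xs)")
    case True
    then have hd: "hd xs \<in> set xs" by (cases xs) auto
    have "\<not> set xs \<subseteq> {hd xs}" using True
      by (metis affine_independent_1 affine_independent_subset)
    then obtain q where "q \<in> set xs" "q \<noteq> hd xs" by blast
    then obtain F where "F facet_of convex hull set xs" "hd xs \<notin> F"
      using facet_avoiding_point[of "convex hull set xs" "hd xs" q] hd
      by (metis List.finite_set hull_inc polytope_convex_hull)
    then show ?thesis using 1[of F] True by (subst pulling.simps) auto
  next
    case False
    then show ?thesis by (subst pulling.simps) auto
  qed
qed

section \<open>Width one and the rounding property\<close>

text \<open>Pairing a linear combination of points of height one with \<open>w\<close> gives the sum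
  of its coefficients; at height one the combination is affine.\<close>

lemma span_height_one_affine_hull:
  fixes S :: "'a::euclidean_space set"
  assumes "v \<in> span S" "\<And>s. s \<in> S \<Longrightarrow> w \<bullet> s = 1" "w \<bullet> v = 1"
  shows "v \<in> affine hull S"
proof -
  obtain T u where T: "finite T" "T \<subseteq> S" "v = (\<Sum>s\<in>T. u s *\<^sub>R s)"
    using assms(1) unfolding span_explicit by blast
  have "w \<bullet> v = (\<Sum>s\<in>T. u s * (w \<bullet> s))" using T(3) by (simp add: inner_sum_right)
  also have "\<dots> = sum u T" using T(2) assms(2) by (intro sum.cong) auto
  finally have "sum u T = 1" using assms(3) by simp
  moreover from this have "T \<noteq> {}" by auto
  ultimately show ?thesis using T unfolding affine_hull_explicit by blast
qed

text \<open>A two-level condition: the points of \<open>S\<close> off a facet all lie on one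
  hyperplane parallel to it. It is required of every inequality \<open>(a, c)\<close> that describes
  the facet.\<close>

definition width_one :: "'a::euclidean_space set \<Rightarrow> bool" where
  "width_one S \<longleftrightarrow> (\<forall>a c. convex hull S \<subseteq> {x. a \<bullet> x \<le> c} \<longrightarrow>
     (convex hull S \<inter> {x. a \<bullet> x = c}) facet_of convex hull S \<longrightarrow>
     (\<forall>p\<in>S. \<forall>q\<in>S. a \<bullet> p \<noteq> c \<longrightarrow> a \<bullet> q \<noteq> c \<longrightarrow> a \<bullet> p = a \<bullet> q))"

text \<open>The facet description of the cone over the polytope at height one:
  \<open>a \<bullet> x \<le> c\<close> homogenises to
  \<open>a \<bullet> v \<le> c * (w \<bullet> v)\<close>. At positive height one rescales
  \<open>v\<close> into the polytope.\<close>

lemma nonneg_hullI_facets: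
  fixes S :: "'a::euclidean_space set"
  assumes "finite S" "S \<noteq> {}" and w: "\<And>s. s \<in> S \<Longrightarrow> w \<bullet> s = 1"
    and v: "v \<in> span S" "0 \<le> w \<bullet> v"
    and facets: "\<And>a c. convex hull S \<subseteq> {x. a \<bullet> x \<le> c} \<Longrightarrow>
      (convex hull S \<inter> {x. a \<bullet> x = c}) facet_of convex hull S \<Longrightarrow> a \<bullet> v \<le> c * (w \<bullet> v)"
  shows "v \<in> nonneg_hull S"
proof -
  let ?P = "convex hull S"
  have poly: "polytope ?P" using assms(1) by (simp add: polytope_convex_hull)
  have mem: "z \<in> ?P" if z: "z \<in> span S" "w \<bullet> z = 1"
    and le: "\<And>a c. ?P \<subseteq> {x. a \<bullet> x \<le> c} \<Longrightarrow> (?P \<inter> {x. a \<bullet> x = c}) facet_of ?P \<Longrightarrow> a \<bullet> z \<le> c" for z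
  proof (rule ccontr)
    assume "z \<notin> ?P"
    moreover have "z \<in> affine hull ?P"
      using span_height_one_affine_hull[OF z(1) w z(2)] by simp
    ultimately obtain a c where "?P \<subseteq> {x. a \<bullet> x \<le> c}" "(?P \<inter> {x. a \<bullet> x = c}) facet_of ?P" "c < a \<bullet> z"
      using facet_separation[OF polytope_imp_polyhedron[OF poly]] by blast
    then show False using le by fastforce
  qed
  show ?thesis
  proof (cases "w \<bullet> v = 0")
    case False
    then have pos: "0 < w \<bullet> v" using v by simp
    have "(1 / (w \<bullet> v)) *\<^sub>R v \<in> ?P"
    proof (rule mem)
      show "(1 / (w \<bullet> v)) *\<^sub>R v \<in> span S" using v by (intro span_scale)
      show "w \<bullet> ((1 / (w \<bullet> v)) *\<^sub>R v) = 1" using pos by simp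
      show "a \<bullet> ((1 / (w \<bullet> v)) *\<^sub>R v) \<le> c"
        if "?P \<subseteq> {x. a \<bullet> x \<le> c}" "(?P \<inter> {x. a \<bullet> x = c}) facet_of ?P" for a c
        using facets[OF that] pos by (simp add: field_simps)
    qed
    then have "(1 / (w \<bullet> v)) *\<^sub>R v \<in> nonneg_hull S"
      using convex_hull_subset_nonneg_hull by blast
    from nonneg_hull_scaleR[OF this v(2)]
    have "(w \<bullet> v) *\<^sub>R ((1 / (w \<bullet> v)) *\<^sub>R v) \<in> nonneg_hull S" .
    then show ?thesis using pos by simp
  next
    case True
    obtain p where p: "p \<in> S" using assms(2) by blast
    \<comment> \<open>At height zero rescaling is impossible. Here \<open>v\<close> is a recession
      direction of the bounded polytope, which forces \<open>v = 0\<close>.\<close>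
    have ray: "p + r *\<^sub>R v \<in> ?P" if "0 \<le> r" for r
    proof (rule mem)
      show "p + r *\<^sub>R v \<in> span S" using p v by (intro span_add span_scale) (simp_all add: span_base)
      show "w \<bullet> (p + r *\<^sub>R v) = 1" using True w[OF p] by (simp add: inner_add_right)
      fix a c assume a: "?P \<subseteq> {x. a \<bullet> x \<le> c}" "(?P \<inter> {x. a \<bullet> x = c}) facet_of ?P"
      have "a \<bullet> p \<le> c" using a(1) p hull_inc by fastforce
      moreover have "a \<bullet> v \<le> 0" using facets[OF a] True by simp
      ultimately show "a \<bullet> (p + r *\<^sub>R v) \<le> c"
        using mult_nonneg_nonpos[OF that, of "a \<bullet> v"] by (simp add: inner_add_right)
    qed
    have "v = 0" using bounded_ray_trivial[OF polytope_imp_bounded[OF poly] ray] .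
    then show ?thesis by (simp add: nonneg_hull.zero)
  qed
qed

text \<open>A homogenised facet functional \<open>f\<close> that is positive at \<open>s\<close>
  takes only the values 0 and \<open>f \<bullet> s\<close> on \<open>S\<close>, so
  \<open>f \<bullet> b\<close> is an integer multiple \<open>k\<close> of
  \<open>f \<bullet> s\<close>. Nonnegativity after removing \<open>t\<close> copies of
  \<open>s\<close> means \<open>t \<le> k\<close>, hence also
  \<open>\<lceil>t\<rceil> \<le> k\<close>.\<close>

lemma width_one_subtract:
  fixes S :: "'a::euclidean_space set"
  assumes "finite S" and w: "\<And>s. s \<in> S \<Longrightarrow> w \<bullet> s = 1" and "width_one S"
    and b: "b \<in> group_closure S" and s: "s \<in> S" and t: "0 \<le> t"
    and bt: "b - t *\<^sub>R s \<in> nonneg_hull S"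
  shows "b - of_int \<lceil>t\<rceil> *\<^sub>R s \<in> nonneg_hull S"
proof (rule nonneg_hullI_facets[OF assms(1) _ w])
  \<comment> \<open>Used twice: with \<open>w\<close> and \<open>d = 1\<close> for the height, and
    with a facet functional and \<open>d = f \<bullet> s\<close>.\<close>
  have int: "\<exists>k::int. f \<bullet> v = of_int k * d" if v: "v \<in> group_closure S"
      and val: "\<And>s. s \<in> S \<Longrightarrow> f \<bullet> s = 0 \<or> f \<bullet> s = d"
    for f v d
    using v
  proof induction
    case (base s)
    then consider "f \<bullet> s = 0" | "f \<bullet> s = d" using val by force
    then show ?case by cases (auto intro: exI[of _ 0] exI[of _ 1])
  next
    case (diff x y)
    then obtain k l :: int where "f \<bullet> x = of_int k * d" "f \<bullet> y = of_int l * d" by blast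
    then show ?case by (intro exI[of _ "k - l"]) (simp add: inner_diff_right algebra_simps)
  qed
  have ceil: "of_int \<lceil>t\<rceil> \<le> real_of_int k" if "t \<le> of_int k" for k
    using that by (simp add: ceiling_le_iff)
  show "S \<noteq> {}" using s by blast
  show "b - of_int \<lceil>t\<rceil> *\<^sub>R s \<in> span S"
    using b s by (intro span_diff span_scale) (simp_all add: span_base group_closure_subset_span)
  show "0 \<le> w \<bullet> (b - of_int \<lceil>t\<rceil> *\<^sub>R s)"
  proof -
    obtain k :: int where "w \<bullet> b = of_int k" using int[OF b, of w 1] w by auto
    moreover have "0 \<le> w \<bullet> (b - t *\<^sub>R s)" using inner_nonneg_hull_nonneg[OF bt, of w] w by auto
    ultimately show ?thesis using w[OF s] ceil[of k] by (simp add: inner_diff_right)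
  qed
  fix a c assume a: "convex hull S \<subseteq> {x. a \<bullet> x \<le> c}"
    "(convex hull S \<inter> {x. a \<bullet> x = c}) facet_of convex hull S"
  \<comment> \<open>Since \<open>w\<close> is 1 on \<open>S\<close>, this linear functional agrees
    there with the affine slack \<open>c - a \<bullet> x\<close>: it is nonnegative on
    \<open>S\<close> and vanishes exactly on the points of the facet.\<close>
  define f where "f = c *\<^sub>R w - a"
  have f: "f \<bullet> x = c * (w \<bullet> x) - a \<bullet> x" for x by (simp add: f_def inner_diff_left)
  have f0: "0 \<le> f \<bullet> x" if "x \<in> S" for x
    using a(1) w[OF that] hull_inc[OF that, of convex] by (auto simp: f)
  have "0 \<le> f \<bullet> (b - of_int \<lceil>t\<rceil> *\<^sub>R s)"
  proof (cases "f \<bullet> s = 0")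
    case True
    have "0 \<le> f \<bullet> (b - t *\<^sub>R s)" using inner_nonneg_hull_nonneg[OF bt, of f] f0 by auto
    then show ?thesis using True by (simp add: inner_diff_right)
  next
    case False
    then have pos: "0 < f \<bullet> s" using f0[OF s] by simp
    have "f \<bullet> x = 0 \<or> f \<bullet> x = f \<bullet> s" if "x \<in> S" for x
    proof -
      have "a \<bullet> x = c \<or> a \<bullet> s = c \<or> a \<bullet> x = a \<bullet> s"
        using assms(3) a that s unfolding width_one_def by blast
      then show ?thesis using False w[OF that] w[OF s] by (auto simp: f)
    qed
    then obtain k :: int where k: "f \<bullet> b = of_int k * (f \<bullet> s)" using int[OF b] by metis
    have "0 \<le> f \<bullet> (b - t *\<^sub>R s)" using inner_nonneg_hull_nonneg[OF bt, of f] f0 by auto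
    then have "0 \<le> (of_int k - t) * (f \<bullet> s)" using k by (simp add: inner_diff_right algebra_simps)
    then have "t \<le> of_int k" using pos by (simp add: zero_le_mult_iff)
    then have "0 \<le> (of_int k - of_int \<lceil>t\<rceil>) * (f \<bullet> s)" using ceil[of k] pos by simp
    then show ?thesis using k by (simp add: inner_diff_right algebra_simps)
  qed
  then show "a \<bullet> (b - of_int \<lceil>t\<rceil> *\<^sub>R s) \<le> c * (w \<bullet> (b - of_int \<lceil>t\<rceil> *\<^sub>R s))" unfolding f by simp
qed

lemma nonneg_hull_positive_part:
  assumes "v \<in> nonneg_hull S" "v \<noteq> 0"
  obtains s r where "s \<in> S" "0 < r" "v - r *\<^sub>R s \<in> nonneg_hull S"
proof -
  have "v = 0 \<or> (\<exists>s\<in>S. \<exists>r>0. v - r *\<^sub>R s \<in> nonneg_hull S)"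
    using assms(1)
  proof induction
    case (step v s r)
    show ?case
    proof (cases "r = 0")
      case False
      then show ?thesis using step by (intro disjI2 bexI[of _ s] exI[of _ r]) auto
    qed (use step in simp)
  qed simp
  then show ?thesis using assms(2) that by blast
qed

text \<open>Normality of the semigroup, by induction on the height: a generator with positive
  coefficient can be subtracted once without leaving the cone, and this lowers the height by
  one.\<close>

lemma width_one_normal:
  fixes S :: "'a::euclidean_space set"
  assumes "finite S" and w: "\<And>s. s \<in> S \<Longrightarrow> w \<bullet> s = 1" and "width_one S"
    and "v \<in> group_closure S" "v \<in> nonneg_hull S"
  shows "v \<in> semigroup_hull S"
  using assms(4,5)
proof (induction "nat \<lceil>w \<bullet> v\<rceil>" arbitrary: v rule: less_induct)
  case less
  show ?case
  proof (cases "v = 0")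
    case True
    then show ?thesis by (simp add: semigroup_hull.zero)
  next
    case False
    obtain s r where s: "s \<in> S" "0 < r" "v - r *\<^sub>R s \<in> nonneg_hull S"
      using nonneg_hull_positive_part[OF less.prems(2) False] by blast
    \<comment> \<open>Capping \<open>r\<close> at 1 makes \<open>\<lceil>t\<rceil> = 1\<close>, so
      exactly one copy of \<open>s\<close> is removed.\<close>
    define t where "t = min r 1"
    have "v - t *\<^sub>R s = (v - r *\<^sub>R s) + (r - t) *\<^sub>R s" by (simp add: algebra_simps)
    also have "\<dots> \<in> nonneg_hull S" using s by (intro nonneg_hull.step) (auto simp: t_def)
    finally have "v - of_int \<lceil>t\<rceil> *\<^sub>R s \<in> nonneg_hull S"
      using width_one_subtract[OF assms(1) w assms(3) less.prems(1) s(1)] s(2) by (auto simp: t_def)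
    moreover have "\<lceil>t\<rceil> = 1" using s(2) by (auto simp: t_def ceiling_eq_iff)
    ultimately have vs: "v - s \<in> nonneg_hull S" by simp
    have "0 \<le> w \<bullet> (v - s)" using inner_nonneg_hull_nonneg[OF vs, of w] w by auto
    then have "1 \<le> w \<bullet> v" "w \<bullet> (v - s) = w \<bullet> v - 1" using w[OF s(1)] by (auto simp: inner_diff_right)
    then have "nat \<lceil>w \<bullet> (v - s)\<rceil> < nat \<lceil>w \<bullet> v\<rceil>" by simp
    moreover have "v - s \<in> group_closure S"
      using less.prems(1) s(1) by (auto intro: group_closure.intros)
    ultimately have "v - s \<in> semigroup_hull S" using less.hyps vs by blast
    then show ?thesis using semigroup_hull.step[of "v - s" S s] s(1) by simp
  qed
qed

lemma width_one_imp_rounding: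
  fixes S :: "'a::euclidean_space set"
  assumes "finite S" "\<And>s. s \<in> S \<Longrightarrow> w \<bullet> s = 1" "width_one S"
  shows "rounding S"
  unfolding rounding_def
proof (intro ballI allI impI)
  fix b s and t :: real
  assume b: "b \<in> semigroup_hull S" and s: "s \<in> S" and t: "0 \<le> t"
    and bt: "b - t *\<^sub>R s \<in> nonneg_hull S"
  have b': "b \<in> group_closure S" using semigroup_hull_subset_group_closure[OF b] .
  have "s \<in> group_closure S" using s by (simp add: group_closure.base)
  then have "b - of_int \<lceil>t\<rceil> *\<^sub>R s \<in> group_closure S"
    using b' by (intro group_closure.diff group_closure_scaleR_int)
  then show "b - of_int \<lceil>t\<rceil> *\<^sub>R s \<in> semigroup_hull S"
    using width_one_normal[OF assms] width_one_subtract[OF assms b' s t bt] by blast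
qed

text \<open>The summands of \<open>c\<close> are removed one by one. All intermediate differences
  stay in the cone, and rounding with \<open>t = 1\<close> keeps them in the semigroup.\<close>

lemma rounding_normal:
  assumes "rounding S" "b \<in> semigroup_hull S" "c \<in> semigroup_hull S" "b - c \<in> nonneg_hull S"
  shows "b - c \<in> semigroup_hull S"
  using assms(3,4)
proof induction
  case zero
  then show ?case using assms(2) by simp
next
  case (step c s)
  have "b - (c + s) + s \<in> nonneg_hull S"
    using step by (blast intro: nonneg_hull_add nonneg_hull_base)
  then have "b - c \<in> semigroup_hull S" using step.IH by simp
  moreover have "b - c - 1 *\<^sub>R s \<in> nonneg_hull S" using step.prems by (simp add: algebra_simps)
  ultimately have "b - c - of_int \<lceil>1::real\<rceil> *\<^sub>R s \<in> semigroup_hull S"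
    using roundingD[OF assms(1) _ step.hyps(2)] by (metis zero_le_one)
  then show ?case by (simp add: algebra_simps)
qed

text \<open>By normality a lattice point of the polytope is a sum of generators, and its height one
  leaves a single summand.\<close>

lemma rounding_lattice_points:
  fixes S :: "'a::euclidean_space set"
  assumes "rounding S" "\<And>s. s \<in> S \<Longrightarrow> w \<bullet> s = 1"
  shows "convex hull S \<inter> group_closure S = S"
proof
  show "convex hull S \<inter> group_closure S \<subseteq> S"
  proof
    fix v assume v: "v \<in> convex hull S \<inter> group_closure S"
    obtain b c where bc: "b \<in> semigroup_hull S" "c \<in> semigroup_hull S" "v = b - c"
      using group_closure_eq_semigroup_diff v by blast
    then have "v \<in> semigroup_hull S"
      using rounding_normal[OF assms(1)] v convex_hull_subset_nonneg_hull by blast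
    moreover have "convex hull S \<subseteq> {x. w \<bullet> x = 1}"
      using assms(2) by (intro hull_minimal convex_hyperplane) auto
    ultimately show "v \<in> S" using semigroup_hull_height_one assms(2) v by blast
  qed
  show "S \<subseteq> convex hull S \<inter> group_closure S"
    by (auto intro: hull_inc group_closure.base)
qed

lemma rounding_face:
  assumes "rounding S" "\<And>s. s \<in> S \<Longrightarrow> 0 \<le> f \<bullet> s"
  shows "rounding {s \<in> S. f \<bullet> s = 0}"
  unfolding rounding_def
proof (intro ballI allI impI)
  let ?T = "{s \<in> S. f \<bullet> s = 0}"
  fix b s and t :: real
  assume b: "b \<in> semigroup_hull ?T" and s: "s \<in> ?T" and t: "0 \<le> t"
    and bt: "b - t *\<^sub>R s \<in> nonneg_hull ?T"
  have "b \<in> semigroup_hull S" "b - t *\<^sub>R s \<in> nonneg_hull S"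
    using semigroup_hull_mono[OF b] nonneg_hull_mono[OF bt] by auto
  then have "b - of_int \<lceil>t\<rceil> *\<^sub>R s \<in> semigroup_hull S"
    using roundingD[OF assms(1)] s t by blast
  moreover have "f \<bullet> b = 0"
    using b by induction (auto simp: inner_add_right)
  then have "f \<bullet> (b - of_int \<lceil>t\<rceil> *\<^sub>R s) = 0" using s by (simp add: inner_diff_right)
  ultimately show "b - of_int \<lceil>t\<rceil> *\<^sub>R s \<in> semigroup_hull ?T"
    using semigroup_hull_face assms(2) by blast
qed

text \<open>A coefficient \<open>c\<close> of \<open>x\<close> becomes nonnegative once at least
  \<open>\<bar>c\<bar>\<close> copies of \<open>x\<close> are added.\<close>

lemma span_shift_nonneg_hull:
  assumes "z \<in> span T"
  obtains u where "u \<in> semigroup_hull T" "z + u \<in> nonneg_hull T"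
proof -
  have "\<exists>u\<in>semigroup_hull T. z + u \<in> nonneg_hull T"
    using assms
  proof (induction rule: span_induct_alt)
    case base
    then show ?case using semigroup_hull.zero nonneg_hull.zero by force
  next
    case (step c x y)
    then obtain u where u: "u \<in> semigroup_hull T" "y + u \<in> nonneg_hull T" by blast
    define n where "n = nat \<lceil>\<bar>c\<bar>\<rceil>"
    have n: "0 \<le> c + of_nat n" unfolding n_def by linarith
    have "u + of_nat n *\<^sub>R x \<in> semigroup_hull T"
      using u step.hyps by (blast intro: semigroup_hull_add semigroup_hull_scaleR_nat semigroup_hull_base)
    moreover have "(y + u) + (c + of_nat n) *\<^sub>R x \<in> nonneg_hull T"
      using u step.hyps n by (intro nonneg_hull.step)
    then have "c *\<^sub>R x + y + (u + of_nat n *\<^sub>R x) \<in> nonneg_hull T"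
      by (simp add: algebra_simps)
    ultimately show ?case by blast
  qed
  then show ?thesis using that by blast
qed

text \<open>Rounding \<open>k\<close> up keeps the shifted vector in the semigroup, where
  \<open>f\<close> is nonnegative, yet its value there is
  \<open>(k - \<lceil>k\<rceil>) * (f \<bullet> h)\<close>. Hence \<open>k\<close> is an integer,
  and what remains after removing \<open>k\<close> copies of \<open>h\<close> lies on the
  face.\<close>

lemma rounding_facet_complement:
  assumes "rounding S" and f: "\<And>s. s \<in> S \<Longrightarrow> 0 \<le> f \<bullet> s"
    and s: "s \<in> S" and h: "h \<in> S" "0 < f \<bullet> h"
    and k: "s - k *\<^sub>R h \<in> span {s \<in> S. f \<bullet> s = 0}"
  shows "s \<in> group_closure (insert h {s \<in> S. f \<bullet> s = 0})"
proof -
  let ?T = "{s \<in> S. f \<bullet> s = 0}"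
  have "f \<bullet> (s - k *\<^sub>R h) = 0"
    using k by (induction rule: span_induct_alt) (auto simp: inner_add_right)
  then have fs: "f \<bullet> s = k * (f \<bullet> h)" by (simp add: inner_diff_right)
  then have k0: "0 \<le> k" using f[OF s] h(2) by (simp add: zero_le_mult_iff)
  \<comment> \<open>The shift \<open>u\<close> brings \<open>s - k *\<^sub>R h\<close> into the cone
    of the face without changing its value under \<open>f\<close>.\<close>
  obtain u where u: "u \<in> semigroup_hull ?T" "s - k *\<^sub>R h + u \<in> nonneg_hull ?T"
    using span_shift_nonneg_hull[OF k] by blast
  have "s + u \<in> semigroup_hull S"
    using semigroup_hull_mono[OF u(1), of S] s by (auto intro: semigroup_hull_add semigroup_hull_base)
  moreover have "(s + u) - k *\<^sub>R h \<in> nonneg_hull S"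
    using nonneg_hull_mono[OF u(2), of S] by (simp add: algebra_simps)
  ultimately have sg: "(s + u) - of_int \<lceil>k\<rceil> *\<^sub>R h \<in> semigroup_hull S"
    using roundingD[OF assms(1)] h(1) k0 by blast
  have fu: "f \<bullet> u = 0" using u(1) by induction (auto simp: inner_add_right)
  have feq: "f \<bullet> ((s + u) - of_int \<lceil>k\<rceil> *\<^sub>R h) = (k - of_int \<lceil>k\<rceil>) * (f \<bullet> h)"
    using fs fu by (simp add: inner_diff_right inner_add_right algebra_simps)
  have "0 \<le> f \<bullet> ((s + u) - of_int \<lceil>k\<rceil> *\<^sub>R h)"
    using inner_nonneg_hull_nonneg[OF semigroup_hull_subset_nonneg_hull[OF sg]] f by blast
  then have "of_int \<lceil>k\<rceil> \<le> k" using feq h(2) by (simp add: zero_le_mult_iff)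
  then have "of_int \<lceil>k\<rceil> = k" by linarith
  then have "f \<bullet> ((s + u) - of_int \<lceil>k\<rceil> *\<^sub>R h) = 0"
    unfolding feq by (simp only: diff_self mult_zero_left)
  then have "(s + u) - of_int \<lceil>k\<rceil> *\<^sub>R h \<in> semigroup_hull ?T"
    by (intro semigroup_hull_face[OF sg]) (auto intro: f)
  then have "(s + u) - of_int \<lceil>k\<rceil> *\<^sub>R h \<in> group_closure (insert h ?T)"
    "u \<in> group_closure (insert h ?T)"
    using u(1) by (auto intro!: semigroup_hull_subset_group_closure elim!: semigroup_hull_mono)
  moreover have "of_int \<lceil>k\<rceil> *\<^sub>R h \<in> group_closure (insert h ?T)"
    by (intro group_closure_scaleR_int group_closure.base) simp
  ultimately have "((s + u) - of_int \<lceil>k\<rceil> *\<^sub>R h) - u + of_int \<lceil>k\<rceil> *\<^sub>R h \<in> group_closure (insert h ?T)"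
    by (rule group_closure_add[OF group_closure.diff])
  then show ?thesis by simp
qed

lemma affine_hull_facet_insert:
  fixes P :: "'a::euclidean_space set"
  assumes "F facet_of P" "h \<in> P" "h \<notin> affine hull F"
  shows "affine hull (insert h F) = affine hull P"
proof -
  have "insert h F \<subseteq> P" using assms facet_of_imp_subset by blast
  moreover have "aff_dim (insert h F) = aff_dim P"
    using assms(1,3) by (simp add: facet_of_def aff_dim_insert)
  ultimately show ?thesis using aff_dim_eq_full_gen by blast
qed

text \<open>Induction along the recursion: the points on a facet inherit the rounding property, the
  simplex inside the facet generates their group, and \<open>rounding_facet_complement\<close> adds
  the apex. The affine hull is carried along because independence requires the apex to lie off the
  hull of the smaller simplex.\<close>

lemma rounding_pulling:
  fixes xs :: "'a::euclidean_space list"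
  assumes "rounding (set xs)" "\<And>s. s \<in> set xs \<Longrightarrow> w \<bullet> s = 1" "\<sigma> \<in> pulling xs"
  shows "\<not> affine_dependent \<sigma> \<and> affine hull \<sigma> = affine hull set xs \<and> set xs \<subseteq> group_closure \<sigma>"
  using assms
proof (induction xs arbitrary: \<sigma> rule: pulling.induct)
  case (1 xs)
  note round = 1(2) and w = 1(3) and \<sigma> = 1(4) and IH = 1(1)
  let ?S = "set xs" and ?P = "convex hull set xs" and ?h = "hd xs"
  show ?case
  proof (cases "affine_dependent ?S")
    case False
    then have "\<sigma> = ?S" using \<sigma> by (subst (asm) pulling.simps) auto
    then show ?thesis using False by (auto intro: group_closure.base)
  next
    case True
    then have hS: "?h \<in> ?S" by (cases xs) auto
    obtain F \<tau> where F: "F facet_of ?P" "?h \<notin> F"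
      and \<tau>: "\<tau> \<in> pulling (filter (\<lambda>x. x \<in> F) xs)" "\<sigma> = insert ?h \<tau>"
      using \<sigma> True by (subst (asm) pulling.simps) auto
    have poly: "polyhedron ?P" by (simp add: polytope_convex_hull polytope_imp_polyhedron)
    obtain a c where a: "?P \<subseteq> {x. a \<bullet> x \<le> c}" "F = ?P \<inter> {x. a \<bullet> x = c}"
      using facet_hyperplane[OF poly F(1)] by blast
    define f where "f = c *\<^sub>R w - a"
    have f: "f \<bullet> x = c - a \<bullet> x" if "x \<in> ?S" for x using w[OF that] by (simp add: f_def inner_diff_left)
    have SP: "?S \<subseteq> ?P" by (rule hull_subset)
    have f0: "0 \<le> f \<bullet> x" if "x \<in> ?S" for x using a(1) f[OF that] SP that by auto
    have filter: "set (filter (\<lambda>x. x \<in> F) xs) = {s \<in> ?S. f \<bullet> s = 0}" (is "_ = ?T")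
      using a(2) f SP by auto
    have "F face_of ?P" using F(1) facet_of_imp_face_of by blast
    then have FT: "F = convex hull ?T"
      using face_eq_convex_hull_Int[of ?S F] filter by (simp add: Int_def)
    have \<tau>': "\<not> affine_dependent \<tau> \<and> affine hull \<tau> = affine hull ?T \<and> ?T \<subseteq> group_closure \<tau>"
      using IH[of F \<tau>] True F \<tau>(1) rounding_face[OF round f0] w unfolding filter by auto
    have "affine hull F \<subseteq> {x. a \<bullet> x = c}"
      using a(2) by (intro hull_minimal) (auto simp: affine_hyperplane)
    moreover have "a \<bullet> ?h \<noteq> c" using F(2) a(2) hS SP by auto
    ultimately have hF: "?h \<notin> affine hull F" by blast
    have hull: "affine hull (insert ?h F) = affine hull ?S"
      using affine_hull_facet_insert[OF F(1) _ hF] hS SP by auto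
    have \<tau>F: "affine hull \<tau> = affine hull F" using \<tau>' FT by simp
    have indep: "\<not> affine_dependent \<sigma>"
      using \<tau>(2) \<tau>' hF \<tau>F affine_independent_insert by metis
    moreover have "affine hull \<sigma> = affine hull ?S"
      using hull \<tau>F \<tau>(2) by (metis hull_insert)
    moreover have "?S \<subseteq> group_closure \<sigma>"
    proof
      fix s assume s: "s \<in> ?S"
      have "s \<in> affine hull (insert ?h F)" using hull s by (simp add: hull_inc)
      then have "s \<in> span (insert ?h F)" using affine_hull_subset_span by blast
      \<comment> \<open>The facet and the apex affinely span the whole configuration; this supplies
        the real coefficient whose integrality is then forced.\<close>
      then obtain k where "s - k *\<^sub>R ?h \<in> span F" using span_breakdown_eq by metis
      also have "span F \<subseteq> span ?T"
        unfolding FT by (intro span_minimal convex_hull_subset_span subspace_span)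
      finally have "s \<in> group_closure (insert ?h ?T)"
        using rounding_facet_complement[OF round f0 s hS] f0[OF hS] f[OF hS] \<open>a \<bullet> ?h \<noteq> c\<close> by force
      moreover have "insert ?h ?T \<subseteq> group_closure \<sigma>"
        using \<tau>' \<tau>(2) group_closure_mono[of _ \<tau> \<sigma>] by (auto intro: group_closure.base)
      ultimately show "s \<in> group_closure \<sigma>" by (rule group_closure_subset)
    qed
    ultimately show ?thesis by blast
  qed
qed

section \<open>Volumes of simplices\<close>

text \<open>Unlike \<open>measure_linear_image\<close>, this needs no well-order on the index type: the determinant
  of a shear is computed by a row operation instead of from a triangular matrix.\<close>

lemma measure_linear_image_finite:
  fixes f :: "real^'m \<Rightarrow> real^'m"
  assumes "linear f" "S \<in> lmeasurable"
  shows "measure lebesgue (f ` S) = \<bar>det (matrix f)\<bar> * measure lebesgue S"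
proof -
  let ?Q = "\<lambda>f::real^'m \<Rightarrow> real^'m. \<forall>S\<in>lmeasurable.
    f ` S \<in> lmeasurable \<and> measure lebesgue (f ` S) = \<bar>det (matrix f)\<bar> * measure lebesgue S"
  \<comment> \<open>A linear map that preserves the volume of boxes preserves all measures; this
    settles coordinate swaps and shears.\<close>
  have unimodular: "?Q h"
    if "linear h" "\<And>a b. measure lebesgue (h ` cbox a b) = measure lebesgue (cbox a b)"
      "\<bar>det (matrix h)\<bar> = 1" for h
  proof
    fix S :: "(real^'m) set" assume "S \<in> lmeasurable"
    then have "h ` S \<in> lmeasurable \<and> 1 * measure lebesgue S = measure lebesgue (h ` S)"
      by (rule measure_linear_sufficient[OF that(1)]) (simp only: that(2) mult_1)
    then show "h ` S \<in> lmeasurable \<and> measure lebesgue (h ` S) = \<bar>det (matrix h)\<bar> * measure lebesgue S"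
      by (simp add: that(3))
  qed
  have "?Q f"
  proof (rule induct_linear_elementary[OF assms(1)])
    fix f g :: "real^'m \<Rightarrow> real^'m"
    assume fg: "linear f" "linear g" "?Q f" "?Q g"
    then show "?Q (f \<circ> g)"
      unfolding image_comp[symmetric] matrix_compose[OF fg(2,1)] det_mul abs_mult mult.assoc
      by (simp del: image_image)
  next
    fix f :: "real^'m \<Rightarrow> real^'m" and i
    assume f: "linear f" and zero: "\<And>x. f x $ i = 0"
    have "axis i 1 \<notin> range f" using zero by (metis axis_nth imageE zero_neq_one)
    then have "\<not> inj f" using linear_injective_imp_surjective[OF f] by blast
    moreover from this have "negligible (f ` S)" for S
      using negligible_linear_singular_image[OF f] by blast
    ultimately show "?Q f"
      using det_nz_iff_inj[OF f] by (auto simp: negligible_iff_measure)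
  next
    fix c :: "'m \<Rightarrow> real"
    show "?Q (\<lambda>x. \<chi> i. c i * x $ i)"
      by (simp add: measurable_stretch measure_stretch matrix_def det_diagonal axis_def)
  next
    fix m n :: 'm
    let ?\<pi> = "Transposition.transpose m n"
    let ?h = "\<lambda>x::real^'m. \<chi> i. x $ ?\<pi> i"
    have lin: "linear ?h" by (rule linearI) (auto simp: vec_eq_iff)
    have perm: "?\<pi> permutes UNIV" by (rule permutes_swap_id) auto
    have inv: "?h (?h x) = x" for x by (simp add: vec_eq_iff)
    have box: "?h ` cbox a b = cbox (?h a) (?h b)" for a b
    proof -
      have all: "(\<forall>i. P (?\<pi> i)) \<longleftrightarrow> (\<forall>i. P i)" for P by (metis transpose_involutory)
      have mem: "?h x \<in> cbox (?h a) (?h b) \<longleftrightarrow> x \<in> cbox a b" for x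
        using all[of "\<lambda>i. a $ i \<le> x $ i \<and> x $ i \<le> b $ i"] by (simp add: mem_box_cart)
      show ?thesis
      proof (intro set_eqI iffI)
        fix x assume "x \<in> cbox (?h a) (?h b)"
        then have "?h x \<in> cbox a b" by (subst mem[symmetric]) (simp only: inv)
        then show "x \<in> ?h ` cbox a b" by (rule image_eqI[of x ?h, rotated]) (simp only: inv)
      qed (use mem in blast)
    qed
    have "measure lebesgue (?h ` cbox a b) = measure lebesgue (cbox a b)" for a b
    proof (cases "cbox a b = {}")
      case False
      then have "cbox (?h a) (?h b) \<noteq> {}" using box by blast
      moreover have "(\<Prod>i\<in>UNIV. b $ ?\<pi> i - a $ ?\<pi> i) = (\<Prod>i\<in>UNIV. b $ i - a $ i)"
        using prod.permute[OF perm, of "\<lambda>i. b $ i - a $ i"] by (simp add: o_def)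
      ultimately show ?thesis using False unfolding box by (simp add: content_cbox_cart)
    qed simp
    moreover have "matrix ?h = (\<chi> i. mat 1 $ ?\<pi> i)"
      by (auto simp: matrix_def mat_def axis_def vec_eq_iff)
    then have "\<bar>det (matrix ?h)\<bar> = 1"
      using perm by (simp add: det_permute_rows sign_swap_id)
    ultimately show "?Q ?h" by (intro unimodular lin)
  next
    fix m n :: 'm
    assume "m \<noteq> n"
    let ?h = "\<lambda>x::real^'m. \<chi> i. if i = m then x $ m + x $ n else x $ i"
    have lin: "linear ?h" by (rule linearI) (auto simp: vec_eq_iff algebra_simps)
    have "measure lebesgue (?h ` cbox a b) = measure lebesgue (cbox a b)" for a b
    proof (cases "cbox a b = {}")
      case False
      \<comment> \<open>Translates the box so that its lower corner has coordinate 0 in direction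
        \<open>n\<close>, since the volume formula for sheared intervals needs that coordinate to be
        nonnegative.\<close>
      define t where "t = axis n (a $ n)"
      have ab: "cbox a b = (+) t ` cbox (a - t) (b - t)" by (simp add: cbox_translation[symmetric])
      then have "?h ` cbox a b = (+) (?h t) ` ?h ` cbox (a - t) (b - t)"
        by (simp only: image_image linear_add[OF lin])
      then have "measure lebesgue (?h ` cbox a b) = measure lebesgue (?h ` cbox (a - t) (b - t))"
        by (simp only: measure_translation)
      also have "\<dots> = measure lebesgue (cbox (a - t) (b - t))"
        using \<open>m \<noteq> n\<close> False ab by (intro measure_shear_interval) (auto simp: t_def)
      also have "\<dots> = measure lebesgue (cbox a b)" by (simp only: ab measure_translation)
      finally show ?thesis .
    qed simp
    moreover have "matrix ?h = (\<chi> k. if k = m then row m (mat 1) + 1 *s row n (mat 1) else row k (mat 1))"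
      by (auto simp: matrix_def mat_def axis_def row_def vec_eq_iff)
    then have "det (matrix ?h) = 1" by (simp only: det_row_operation[OF \<open>m \<noteq> n\<close>] det_I)
    ultimately show "?Q ?h" by (intro unimodular lin) simp_all
  qed
  then show ?thesis using assms(2) by blast
qed

section \<open>Determinants computed in an arbitrary basis\<close>

lemma span_range_basis:
  fixes e :: "'m::finite \<Rightarrow> real^'m"
  assumes "inj e" "independent (range e)"
  shows "span (range e) = UNIV"
proof -
  have "card (range e) = dim (UNIV :: (real^'m) set)" using assms(1) by (simp add: card_image)
  then show ?thesis
    using card_ge_dim_independent[of "range e" UNIV] assms(2) by auto
qed

text \<open>The standard matrix of \<open>f\<close> and its matrix \<open>N\<close> in the basis
  \<open>e\<close> are similar through the matrix \<open>M\<close> with columns \<open>e k\<close>,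
  and \<open>det M\<close> cancels.\<close>

lemma det_matrix_basis:
  fixes f :: "real^'m \<Rightarrow> real^'m" and e :: "'m \<Rightarrow> real^'m"
  assumes "linear f" "inj e" "independent (range e)"
  shows "det (matrix f) = det (\<chi> l k. representation (range e) (f (e k)) (e l))"
proof -
  define M :: "real^'m^'m" where "M = (\<chi> i k. e k $ i)"
  define N :: "real^'m^'m" where "N = (\<chi> l k. representation (range e) (f (e k)) (e l))"
  have M: "M *v x = (\<Sum>k\<in>UNIV. x $ k *\<^sub>R e k)" for x
    by (simp add: M_def matrix_mult_sum scalar_mult_eq_scaleR column_def vec_nth_inverse)
  have rep: "M *v (\<chi> l. representation (range e) v (e l)) = v" for v
  proof -
    have "M *v (\<chi> l. representation (range e) v (e l))
        = (\<Sum>b\<in>range e. representation (range e) v b *\<^sub>R b)"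
      using assms(2) by (simp add: M sum.reindex)
    also have "\<dots> = v"
      using assms span_range_basis[OF assms(2,3)] by (intro sum_representation_eq) auto
    finally show ?thesis .
  qed
  then have "surj ((*v) M)" by (rule surjI)
  then have detM: "det M \<noteq> 0"
    using matrix_right_invertible_surjective invertible_right_inverse invertible_det_nz by blast
  have "matrix f ** M = M ** N"
  proof (rule matrix_eq[THEN iffD2], rule allI)
    fix x
    have "(matrix f ** M) *v x = f (\<Sum>k\<in>UNIV. x $ k *\<^sub>R e k)"
      using assms(1) by (simp add: M matrix_vector_mul_assoc[symmetric])
    also have "\<dots> = (\<Sum>k\<in>UNIV. x $ k *\<^sub>R f (e k))"
      using assms(1) by (simp add: linear_sum linear_scale)
    also have "\<dots> = (\<Sum>k\<in>UNIV. x $ k *\<^sub>R (M *v column k N))"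
      using rep by (simp add: N_def column_def)
    also have "\<dots> = M *v (\<Sum>k\<in>UNIV. x $ k *\<^sub>R column k N)"
      by (simp add: linear_sum[OF matrix_vector_mul_linear] matrix_vector_mult_scaleR)
    also have "\<dots> = (M ** N) *v x"
      by (simp add: matrix_vector_mul_assoc[symmetric] matrix_mult_sum[of N] scalar_mult_eq_scaleR)
    finally show "(matrix f ** M) *v x = (M ** N) *v x" .
  qed
  then have "det (matrix f) * det M = det M * det N" by (metis det_mul)
  then show ?thesis using detM by (simp add: N_def)
qed

lemma det_Ints:
  fixes N :: "real^'m^'m"
  assumes "\<And>i j. N $ i $ j \<in> \<int>"
  shows "det N \<in> \<int>"
  unfolding det_def using assms by (auto intro!: Ints_sum Ints_mult Ints_prod)

text \<open>Elements of the lattice spanned by the basis have integral coordinates in it, so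
  \<open>f\<close> has an integral matrix there.\<close>

lemma det_lattice_map:
  fixes f :: "real^'m \<Rightarrow> real^'m" and e :: "'m \<Rightarrow> real^'m"
  assumes "linear f" "inj e" "independent (range e)" "\<And>k. f (e k) \<in> group_closure (range e)"
  shows "det (matrix f) \<in> \<int>"
proof -
  have "representation (range e) v b \<in> \<int>" if "v \<in> group_closure (range e)" for v b
    using that
  proof induction
    case (base s)
    then show ?case
      using assms(3) by (auto simp: representation_zero representation_basis)
  next
    case (diff s t)
    then show ?case
      using assms(3) span_range_basis[OF assms(2,3)] by (simp add: representation_diff)
  qed
  then show ?thesis
    unfolding det_matrix_basis[OF assms(1-3)] using assms(4) by (intro det_Ints) simp
qed

text \<open>In the basis \<open>e\<close> the matrix of \<open>f\<close> is the identity with column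
  \<open>k\<close> replaced, so Cramer's rule reads off its determinant.\<close>

lemma det_replace_basis_vector:
  fixes f :: "real^'m \<Rightarrow> real^'m" and e :: "'m \<Rightarrow> real^'m"
  assumes "linear f" "inj e" "independent (range e)" "\<And>l. l \<noteq> k \<Longrightarrow> f (e l) = e l"
  shows "det (matrix f) = representation (range e) (f (e k)) (e k)"
proof -
  let ?x = "\<chi> l. representation (range e) (f (e k)) (e l)"
  have "representation (range e) (f (e j)) (e i)
      = (if j = k then (mat 1 *v ?x) $ i else (mat 1 :: real^'m^'m) $ i $ j)" for i j
    using assms(2-4)
    by (cases "j = k")
      (auto simp: representation_basis mat_def inj_eq matrix_vector_mul_lid[unfolded mat_def])
  then have "(\<chi> l j. representation (range e) (f (e j)) (e l))
      = (\<chi> i j. if j = k then (mat 1 *v ?x) $ i else (mat 1 :: real^'m^'m) $ i $ j)"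
    by simp
  then have "det (matrix f) = ?x $ k * det (mat 1 :: real^'m^'m)"
    unfolding det_matrix_basis[OF assms(1-3)] using cramer_lemma[of k "mat 1" ?x] by simp
  then show ?thesis by simp
qed

section \<open>Relative volume through thickened sets\<close>

definition thickening :: "'a::euclidean_space set \<Rightarrow> 'a set" where
  "thickening S = {x + y | x y. x \<in> S \<and> (\<forall>u\<in>S. \<forall>v\<in>S. y \<bullet> (u - v) = 0) \<and> norm y \<le> 1}"

lemma rel_volume_thickening:
  fixes S :: "'a::euclidean_space set"
  shows "rel_volume S = measure lebesgue (thickening S)
    / unit_ball_vol (real_of_int (int DIM('a) - aff_dim S))"
  by (simp add: rel_volume_def thickening_def)

lemma compact_thickening:
  fixes S :: "'a::euclidean_space set"
  assumes "compact S"
  shows "compact (thickening S)"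
proof -
  have "closed {y. \<forall>u\<in>S. \<forall>v\<in>S. y \<bullet> (u - v) = 0}"
  proof -
    have "{y. \<forall>u\<in>S. \<forall>v\<in>S. y \<bullet> (u - v) = 0} = (\<Inter>u\<in>S. \<Inter>v\<in>S. {y. y \<bullet> (u - v) = 0})" by auto
    then show ?thesis by (auto intro!: closed_INT closed_Collect_eq continuous_intros)
  qed
  then have "compact ({y. \<forall>u\<in>S. \<forall>v\<in>S. y \<bullet> (u - v) = 0} \<inter> cball 0 1)"
    by (intro closed_Int_compact) auto
  from compact_sums[OF assms this] show ?thesis by (simp add: thickening_def)
qed

lemma convex_thickening:
  fixes S :: "'a::euclidean_space set"
  assumes "convex S"
  shows "convex (thickening S)"
proof -
  have "convex ({y. \<forall>u\<in>S. \<forall>v\<in>S. y \<bullet> (u - v) = 0} \<inter> cball 0 1)"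
    by (intro convex_Int convex_cball) (auto simp: convex_def inner_add_left)
  from convex_sums[OF assms this] 
  have "convex (\<Union>x\<in>S. \<Union>y\<in>{y. \<forall>u\<in>S. \<forall>v\<in>S. y \<bullet> (u - v) = 0} \<inter> cball 0 1. {x + y})" .
  moreover have "thickening S = (\<Union>x\<in>S. \<Union>y\<in>{y. \<forall>u\<in>S. \<forall>v\<in>S. y \<bullet> (u - v) = 0} \<inter> cball 0 1. {x + y})"
    unfolding thickening_def by auto blast
  ultimately show ?thesis by simp
qed

text \<open>A convex set without interior lies in a hyperplane. Its normal is then orthogonal to all
  differences in \<open>S\<close>, so the thickening contains a unit step along the normal and
  leaves the hyperplane.\<close>

lemma measure_thickening_pos:
  fixes S :: "'a::euclidean_space set"
  assumes "compact S" "convex S" "S \<noteq> {}"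
  shows "0 < measure lebesgue (thickening S)"
proof -
  have "interior (thickening S) \<noteq> {}"
  proof
    assume "interior (thickening S) = {}"
    then obtain a b where a: "a \<noteq> 0" "thickening S \<subseteq> {x. a \<bullet> x = b}"
      using empty_interior_subset_hyperplane[OF convex_thickening[OF assms(2)]] by metis
    have S: "a \<bullet> u = b" if "u \<in> S" for u
    proof -
      have "u + 0 \<in> thickening S" unfolding thickening_def using that by fastforce
      then show ?thesis using a(2) by auto
    qed
    obtain u where u: "u \<in> S" using assms(3) by blast
    have "u + (1 / norm a) *\<^sub>R a \<in> thickening S"
      unfolding thickening_def using u S a(1)
      by (intro CollectI exI[of _ u] exI[of _ "(1 / norm a) *\<^sub>R a"]) (auto simp: inner_diff_right)
    then have "a \<bullet> ((1 / norm a) *\<^sub>R a) = 0" using a(2) S[OF u] by (auto simp: inner_add_right)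
    then show False using a(1) by simp
  qed
  then have "\<not> negligible (thickening S)"
    using negligible_convex_interior convex_thickening[OF assms(2)] by blast
  moreover have "thickening S \<in> lmeasurable"
    using compact_thickening[OF assms(1)] by (rule lmeasurable_compact)
  ultimately show ?thesis
    using negligible_iff_measure zero_less_measure_iff by blast
qed

text \<open>The thickening directions depend only on the affine hull, so simplices with the same
  affine hull are thickened by the same ball.\<close>

lemma orthogonal_convex_hull_iff:
  "(\<forall>u\<in>convex hull S. \<forall>v\<in>convex hull S. y \<bullet> (u - v) = 0) \<longleftrightarrow>
   (\<forall>u\<in>affine hull S. \<forall>v\<in>affine hull S. y \<bullet> (u - v) = 0)"
proof
  assume L: "\<forall>u\<in>convex hull S. \<forall>v\<in>convex hull S. y \<bullet> (u - v) = 0"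
  show "\<forall>u\<in>affine hull S. \<forall>v\<in>affine hull S. y \<bullet> (u - v) = 0"
  proof (cases "S = {}")
    case False
    then obtain a where a: "a \<in> S" by blast
    have "affine hull S \<subseteq> {x. y \<bullet> x = y \<bullet> a}"
    proof (intro hull_minimal)
      show "S \<subseteq> {x. y \<bullet> x = y \<bullet> a}"
      proof
        fix x assume "x \<in> S"
        then have "y \<bullet> (x - a) = 0" using L a by (simp add: hull_inc)
        then show "x \<in> {x. y \<bullet> x = y \<bullet> a}" by (simp add: inner_diff_right)
      qed
    qed (simp add: affine_hyperplane)
    then have "y \<bullet> u = y \<bullet> a" if "u \<in> affine hull S" for u using that by blast
    then show ?thesis by (simp add: inner_diff_right)
  qed simp
next
  assume "\<forall>u\<in>affine hull S. \<forall>v\<in>affine hull S. y \<bullet> (u - v) = 0"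
  then show "\<forall>u\<in>convex hull S. \<forall>v\<in>convex hull S. y \<bullet> (u - v) = 0"
    using convex_hull_subset_affine_hull by blast
qed

text \<open>A basis of the orthogonal complement of \<open>D\<close> completes \<open>D\<close>, by
  counting dimensions. Indexing the result by \<open>'m\<close> makes it usable for
  determinants.\<close>

lemma orthogonal_basis_extension:
  fixes D :: "(real^'m) set"
  assumes "independent D"
  obtains e :: "'m \<Rightarrow> real^'m" where "inj e" "independent (range e)" "D \<subseteq> range e"
    "{y. \<forall>x\<in>D. y \<bullet> x = 0} \<subseteq> span (range e - D)"
proof -
  define V where "V = {y. \<forall>x\<in>D. y \<bullet> x = 0}"
  obtain B where B: "B \<subseteq> V" "independent B" "V \<subseteq> span B" "card B = dim V"
    using basis_exists by blast
  have fin: "finite D" "finite B" using assms B(2) independent_imp_finite by auto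
  have "D \<inter> B = {}"
  proof (rule ccontr)
    assume "D \<inter> B \<noteq> {}"
    then obtain x where "x \<in> D" "x \<in> V" using B(1) by blast
    then have "x = 0" by (auto simp: V_def)
    then show False using \<open>x \<in> D\<close> assms dependent_zero by blast
  qed
  have "V = {y \<in> UNIV. \<forall>x\<in>span D. orthogonal x y}"
    unfolding V_def orthogonal_def 
  proof (intro set_eqI iffI)
    fix y assume y: "y \<in> {y. \<forall>x\<in>D. y \<bullet> x = 0}"
    have "span D \<subseteq> {x. y \<bullet> x = 0}"
      using y by (intro span_minimal) (auto simp: subspace_hyperplane)
    then show "y \<in> {y \<in> UNIV. \<forall>x\<in>span D. x \<bullet> y = 0}" by (auto simp: inner_commute)
  next
    fix y assume "y \<in> {y \<in> UNIV. \<forall>x\<in>span D. x \<bullet> y = 0}"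
    then show "y \<in> {y. \<forall>x\<in>D. y \<bullet> x = 0}" by (auto simp: inner_commute span_base)
  qed
  then have dimV: "dim V + dim (span D) = CARD('m)"
    using dim_subspace_orthogonal_to_vectors[of "span D" UNIV] by simp
  have card: "card (D \<union> B) = CARD('m)"
    using dimV card_Un_disjoint[OF fin \<open>D \<inter> B = {}\<close>] B(4) dim_eq_card_independent[OF assms] by simp
  have "UNIV \<subseteq> span (D \<union> B)"
  proof
    fix x
    obtain y z where x: "y \<in> span D" "\<And>w. w \<in> span D \<Longrightarrow> orthogonal z w" "x = y + z"
      using orthogonal_subspace_decomp_exists[of D x] by blast
    have "z \<in> V" unfolding V_def using x(2) by (auto simp: orthogonal_def span_base)
    then have "z \<in> span B" using B(3) by blast
    then show "x \<in> span (D \<union> B)"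
      using x(1,3) span_mono[of D "D \<union> B"] span_mono[of B "D \<union> B"] by (auto intro!: span_add)
  qed
  then have indep: "independent (D \<union> B)"
    using card_le_dim_spanning[of "D \<union> B" UNIV] fin card by simp
  obtain e where e: "bij_betw e (UNIV :: 'm set) (D \<union> B)"
    using card fin finite_same_card_bij[of "UNIV :: 'm set" "D \<union> B"] by auto
  then have "inj e" "range e = D \<union> B" by (auto simp: bij_betw_def)
  moreover have "(D \<union> B) - D = B" using \<open>D \<inter> B = {}\<close> by blast
  ultimately show ?thesis using that[of e] indep B(3) unfolding V_def by auto
qed

text \<open>An affine map of the affine hull is extended by the identity on the orthogonal complement, so
  that it carries one thickened simplex onto the other.\<close>

lemma simplex_volume_ratio:
  fixes \<sigma> \<tau> :: "(real^'m) set"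
  assumes \<sigma>: "\<not> affine_dependent \<sigma>" "s0 \<in> \<sigma>"
    and hull: "affine hull \<tau> = affine hull \<sigma>" and \<phi>: "\<phi> ` \<sigma> = \<tau>"
  obtains e :: "'m \<Rightarrow> real^'m" and f where "linear f" "inj e" "independent (range e)"
    "(\<lambda>s. s - s0) ` (\<sigma> - {s0}) \<subseteq> range e"
    "\<And>s. s \<in> \<sigma> \<Longrightarrow> f (s - s0) = \<phi> s - \<phi> s0"
    "\<And>k. e k \<notin> (\<lambda>s. s - s0) ` (\<sigma> - {s0}) \<Longrightarrow> f (e k) = e k"
    "rel_volume (convex hull \<tau>) = \<bar>det (matrix f)\<bar> * rel_volume (convex hull \<sigma>)"
proof -
  define D where "D = (\<lambda>s. s - s0) ` (\<sigma> - {s0})"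
  have "independent D"
    using \<sigma> affine_dependent_iff_dependent[of s0 "\<sigma> - {s0}"]
    by (simp add: D_def insert_absorb)
  then obtain e :: "'m \<Rightarrow> real^'m" where e: "inj e" "independent (range e)" "D \<subseteq> range e"
    "{y. \<forall>x\<in>D. y \<bullet> x = 0} \<subseteq> span (range e - D)"
    by (rule orthogonal_basis_extension)
  \<comment> \<open>Edge vectors from \<open>s0\<close> go to the corresponding edge vectors from
    \<open>\<phi> s0\<close>; the remaining basis vectors, which span the orthogonal complement,
    stay fixed.\<close>
  obtain f where f: "linear f" "\<forall>x\<in>range e. f x = (if x \<in> D then \<phi> (x + s0) - \<phi> s0 else x)"
    using linear_independent_extend[OF e(2), of "\<lambda>x. if x \<in> D then \<phi> (x + s0) - \<phi> s0 else x"] by blast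
  have f\<sigma>: "f (s - s0) = \<phi> s - \<phi> s0" if "s \<in> \<sigma>" for s
  proof (cases "s = s0")
    case True
    then show ?thesis using f(1) by (simp add: linear_0)
  next
    case False
    then have "s - s0 \<in> D" using that by (auto simp: D_def)
    then show ?thesis using bspec[OF f(2), of "s - s0"] e(3) by auto
  qed
  have fid: "f (e k) = e k" if "e k \<notin> D" for k using f(2) that by auto
  have orth: "f y = y" if "\<forall>u\<in>convex hull \<sigma>. \<forall>v\<in>convex hull \<sigma>. y \<bullet> (u - v) = 0" for y
  proof -
    have "\<forall>x\<in>D. y \<bullet> x = 0" using that \<sigma>(2) by (auto simp: D_def hull_inc)
    then have y: "y \<in> span (range e - D)" using e(4) by blast
    have "f y = (\<lambda>x. x) y"
      by (rule linear_eq_on[OF f(1) _ y]) (use fid in \<open>auto simp: linear_iff\<close>)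
    then show ?thesis by simp
  qed
  \<comment> \<open>The translation for which \<open>x\<close> to \<open>c + f x\<close> agrees with
    \<open>\<phi>\<close> on all vertices.\<close>
  define c where "c = \<phi> s0 - f s0"
  have f\<phi>: "c + f s = \<phi> s" if "s \<in> \<sigma>" for s
    using f\<sigma>[OF that] f(1) by (simp add: c_def linear_diff algebra_simps)
  have conv: "convex hull \<tau> = (+) c ` f ` (convex hull \<sigma>)"
  proof -
    have "\<tau> = (+) c ` f ` \<sigma>" using \<phi> f\<phi> by (force simp: image_iff)
    then show ?thesis
      using f(1) by (simp add: convex_hull_translation convex_hull_linear_image)
  qed
  have perp: "(\<forall>u\<in>convex hull \<tau>. \<forall>v\<in>convex hull \<tau>. y \<bullet> (u - v) = 0) \<longleftrightarrow>
    (\<forall>u\<in>convex hull \<sigma>. \<forall>v\<in>convex hull \<sigma>. y \<bullet> (u - v) = 0)" for y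
    by (simp add: orthogonal_convex_hull_iff hull)
  have "thickening (convex hull \<tau>) = {c + f x + y | x y. x \<in> convex hull \<sigma> \<and>
      (\<forall>u\<in>convex hull \<sigma>. \<forall>v\<in>convex hull \<sigma>. y \<bullet> (u - v) = 0) \<and> norm y \<le> 1}"
    unfolding thickening_def perp unfolding conv by blast
  also have "\<dots> = {c + f (x + y) | x y. x \<in> convex hull \<sigma> \<and>
      (\<forall>u\<in>convex hull \<sigma>. \<forall>v\<in>convex hull \<sigma>. y \<bullet> (u - v) = 0) \<and> norm y \<le> 1}"
  proof -
    have "c + f x + y = c + f (x + y)"
      if "\<forall>u\<in>convex hull \<sigma>. \<forall>v\<in>convex hull \<sigma>. y \<bullet> (u - v) = 0" for x y
      using orth[OF that] f(1) by (simp add: linear_add)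
    then show ?thesis by (intro Collect_cong) metis
  qed
  also have "\<dots> = (+) c ` f ` thickening (convex hull \<sigma>)"
    unfolding thickening_def by blast
  finally have thick: "thickening (convex hull \<tau>) = (+) c ` f ` thickening (convex hull \<sigma>)" .
  have "finite \<sigma>" using \<sigma>(1) aff_independent_finite by blast
  then have "compact (convex hull \<sigma>)" by (simp add: finite_imp_compact_convex_hull)
  then have "thickening (convex hull \<sigma>) \<in> lmeasurable"
    by (intro lmeasurable_compact compact_thickening)
  then have "measure lebesgue (thickening (convex hull \<tau>))
      = \<bar>det (matrix f)\<bar> * measure lebesgue (thickening (convex hull \<sigma>))"
    unfolding thick using f(1) by (simp add: measure_translation measure_linear_image_finite)
  moreover have "aff_dim (convex hull \<tau>) = aff_dim (convex hull \<sigma>)"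
    using hull by (metis aff_dim_affine_hull aff_dim_convex_hull)
  ultimately have "rel_volume (convex hull \<tau>) = \<bar>det (matrix f)\<bar> * rel_volume (convex hull \<sigma>)"
    by (simp add: rel_volume_thickening)
  then show ?thesis using that[OF f(1) e(1,2)] e(3) f\<sigma> fid unfolding D_def by blast
qed

lemma rel_volume_pos:
  fixes S :: "'a::euclidean_space set"
  assumes "compact S" "convex S" "S \<noteq> {}"
  shows "0 < rel_volume S"
proof -
  have "0 \<le> real_of_int (int DIM('a) - aff_dim S)"
    using aff_dim_le_DIM[of S] by linarith
  then show ?thesis
    using measure_thickening_pos[OF assms] by (simp add: rel_volume_thickening)
qed

text \<open>The linear map taking edges of \<open>\<sigma>\<close> to edges of \<open>\<tau>\<close>
  preserves the lattice of the basis extending the edges of \<open>\<sigma>\<close>. Its determinant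
  is therefore an integer, nonzero because \<open>\<tau>\<close> has positive volume.\<close>

lemma lattice_simplex_volume_le:
  fixes \<sigma> \<tau> :: "(real^'m) set"
  assumes \<sigma>: "\<not> affine_dependent \<sigma>" and \<tau>: "\<not> affine_dependent \<tau>"
    and hull: "affine hull \<tau> = affine hull \<sigma>" and gen: "\<tau> \<subseteq> group_closure \<sigma>"
    and w: "\<And>s. s \<in> \<sigma> \<union> \<tau> \<Longrightarrow> w \<bullet> s = 1"
  shows "rel_volume (convex hull \<sigma>) \<le> rel_volume (convex hull \<tau>)"
proof (cases "\<sigma> = {}")
  case True
  then have "\<tau> = {}" using hull by simp
  then show ?thesis using True by simp
next
  case False
  then obtain s0 where s0: "s0 \<in> \<sigma>" by blast
  have fin: "finite \<sigma>" "finite \<tau>" using \<sigma> \<tau> aff_independent_finite by auto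
  have "aff_dim \<tau> = aff_dim \<sigma>" using hull by (metis aff_dim_affine_hull)
  then have "card \<tau> = card \<sigma>"
    using aff_dim_affine_independent[OF \<sigma>] aff_dim_affine_independent[OF \<tau>] by simp
  then obtain \<phi> where "bij_betw \<phi> \<sigma> \<tau>" using fin finite_same_card_bij by metis
  then have \<phi>: "\<phi> ` \<sigma> = \<tau>" by (simp add: bij_betw_def)
  let ?D = "(\<lambda>s. s - s0) ` (\<sigma> - {s0})"
  obtain e :: "'m \<Rightarrow> real^'m" and f where f: "linear f" "inj e" "independent (range e)" "?D \<subseteq> range e"
    "\<And>s. s \<in> \<sigma> \<Longrightarrow> f (s - s0) = \<phi> s - \<phi> s0"
    "\<And>k. e k \<notin> ?D \<Longrightarrow> f (e k) = e k"
    "rel_volume (convex hull \<tau>) = \<bar>det (matrix f)\<bar> * rel_volume (convex hull \<sigma>)"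
    by (rule simplex_volume_ratio[OF \<sigma> s0 hull \<phi>]) auto
  \<comment> \<open>Subtracting multiples of \<open>s0\<close> according to height passes from the
    group of the vertices to that of the edge vectors; a point of height one loses exactly one
    \<open>s0\<close>.\<close>
  have D: "v - (w \<bullet> v) *\<^sub>R s0 \<in> group_closure ?D" if "v \<in> group_closure \<sigma>" for v
    using that
  proof induction
    case (base s)
    then consider "s = 0" | "s = s0" | "s \<in> \<sigma> - {s0}" by blast
    then show ?case
    proof cases
      case 3
      then have "s - (w \<bullet> s) *\<^sub>R s0 \<in> ?D" using w[of s] by auto
      then show ?thesis by (simp add: group_closure.base)
    qed (use w[of s0] s0 in auto)
  next
    case (diff x y)
    have "x - y - (w \<bullet> (x - y)) *\<^sub>R s0 = (x - (w \<bullet> x) *\<^sub>R s0) - (y - (w \<bullet> y) *\<^sub>R s0)"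
      by (simp add: inner_diff_right algebra_simps)
    then show ?case using group_closure.diff[OF diff.IH] by (simp only:)
  qed
  have "f (e k) \<in> group_closure (range e)" for k
  proof (cases "e k \<in> ?D")
    case True
    then obtain s where s: "s \<in> \<sigma>" "e k = s - s0" by blast
    have "\<phi> x - s0 \<in> group_closure ?D" if "x \<in> \<sigma>" for x
      using D[of "\<phi> x"] \<phi> that gen w[of "\<phi> x"] by auto
    then have "(\<phi> s - s0) - (\<phi> s0 - s0) \<in> group_closure ?D"
      using s s0 by (blast intro: group_closure.diff)
    then have "f (e k) \<in> group_closure ?D" using s f(5) by simp
    then show ?thesis using f(4) by (rule group_closure_mono)
  next
    case False
    then show ?thesis using f(6) by (auto intro: group_closure.base)
  qed
  then have int: "det (matrix f) \<in> \<int>" using det_lattice_map[OF f(1-3)] by blast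
  have "\<tau> \<noteq> {}" using False \<phi> by auto
  then have "0 < rel_volume (convex hull \<tau>)"
    using fin by (intro rel_volume_pos) (auto simp: finite_imp_compact_convex_hull)
  then have "det (matrix f) \<noteq> 0" using f(7) by auto
  then have "1 \<le> \<bar>det (matrix f)\<bar>" using int Ints_nonzero_abs_ge1 by blast
  moreover have "0 < rel_volume (convex hull \<sigma>)"
    using fin False by (intro rel_volume_pos) (auto simp: finite_imp_compact_convex_hull)
  ultimately show ?thesis unfolding f(7) by simp
qed

text \<open>Volumes of pyramids over a common base are proportional to their heights: the map fixing
  the base and moving \<open>p\<close> to \<open>q\<close> has as determinant the coefficient of
  \<open>p - s0\<close> in \<open>q - s0\<close>, and \<open>a\<close> reads it off as a quotient of
  heights.\<close>

lemma pyramid_volume_ratio: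
  fixes \<rho> :: "(real^'m) set"
  assumes p: "\<not> affine_dependent (insert p \<rho>)"
    and hull: "affine hull (insert q \<rho>) = affine hull (insert p \<rho>)"
    and "\<rho> \<noteq> {}" "\<And>x. x \<in> \<rho> \<Longrightarrow> a \<bullet> x = c" "a \<bullet> p \<noteq> c"
  shows "\<bar>a \<bullet> q - c\<bar> * rel_volume (convex hull (insert p \<rho>))
    = \<bar>a \<bullet> p - c\<bar> * rel_volume (convex hull (insert q \<rho>))"
proof -
  obtain s0 where s0: "s0 \<in> \<rho>" using assms(3) by blast
  have p\<rho>: "p \<notin> \<rho>" using assms(4,5) by blast
  define \<phi> where "\<phi> x = (if x = p then q else x)" for x
  have \<phi>: "\<phi> ` insert p \<rho> = insert q \<rho>" using p\<rho> by (auto simp: \<phi>_def)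
  let ?D = "(\<lambda>s. s - s0) ` (insert p \<rho> - {s0})"
  obtain e :: "'m \<Rightarrow> real^'m" and f where f: "linear f" "inj e" "independent (range e)" "?D \<subseteq> range e"
    "\<And>s. s \<in> insert p \<rho> \<Longrightarrow> f (s - s0) = \<phi> s - \<phi> s0"
    "\<And>k. e k \<notin> ?D \<Longrightarrow> f (e k) = e k"
    "rel_volume (convex hull (insert q \<rho>))
       = \<bar>det (matrix f)\<bar> * rel_volume (convex hull (insert p \<rho>))"
    by (rule simplex_volume_ratio[OF p _ hull \<phi>, of s0]) (use s0 in auto)
  have \<phi>0: "\<phi> s0 = s0" using s0 p\<rho> by (auto simp: \<phi>_def)
  have pD: "p - s0 \<in> ?D" using s0 p\<rho> by blast
  then obtain k where k: "e k = p - s0" using f(4) by (metis image_iff subsetD)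
  have "f (e l) = e l" if "l \<noteq> k" for l
  proof (cases "e l \<in> ?D")
    case True
    then obtain s where s: "s \<in> insert p \<rho>" "e l = s - s0" by blast
    have "s \<noteq> p" using s k that f(2) by (metis injD)
    then show ?thesis using f(5)[OF s(1)] s \<phi>0 by (simp add: \<phi>_def)
  qed (rule f(6))
  then have "det (matrix f) = representation (range e) (f (e k)) (e k)"
    by (rule det_replace_basis_vector[OF f(1-3)])
  also have "f (e k) = q - s0" using f(5)[of p] k \<phi>0 by (simp add: \<phi>_def)
  finally have det: "det (matrix f) = representation (range e) (q - s0) (p - s0)" by (simp only: k)
  have "q \<in> affine hull (insert p \<rho>)" using hull hull_inc[of q "insert q \<rho>" affine] by simp
  then have "q \<in> (+) s0 ` span ?D"
    using affine_hull_span2[of s0 "insert p \<rho>"] s0 by simp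
  then have qD: "q - s0 \<in> span ?D" by auto
  have fin: "finite ?D" using aff_independent_finite[OF p] by simp
  have "independent ?D" using f(3,4) independent_mono by blast
  then have sum: "(\<Sum>b\<in>?D. representation ?D (q - s0) b *\<^sub>R b) = q - s0"
    using qD fin by (intro sum_representation_eq) auto
  have "a \<bullet> (q - s0) = a \<bullet> (\<Sum>b\<in>?D. representation ?D (q - s0) b *\<^sub>R b)" by (simp only: sum)
  also have "\<dots> = (\<Sum>b\<in>?D. representation ?D (q - s0) b * (a \<bullet> b))"
    by (simp add: inner_sum_right)
  \<comment> \<open>Edges of the common base are orthogonal to \<open>a\<close>, so only the edge
    \<open>p - s0\<close> contributes.\<close>
  also have "\<dots> = (\<Sum>b\<in>{p - s0}. representation ?D (q - s0) b * (a \<bullet> b))"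
    using pD fin s0 assms(4) by (intro sum.mono_neutral_right) (auto simp: inner_diff_right)
  also have "\<dots> = det (matrix f) * (a \<bullet> (p - s0))"
    using det representation_extend[OF f(3) qD f(4)] by simp
  finally have "a \<bullet> q - c = det (matrix f) * (a \<bullet> p - c)"
    using assms(4)[OF s0] by (simp add: inner_diff_right)
  then have "\<bar>a \<bullet> q - c\<bar> = \<bar>det (matrix f)\<bar> * \<bar>a \<bullet> p - c\<bar>" by (simp add: abs_mult)
  then show ?thesis unfolding f(7) by simp
qed

section \<open>Compressed polytopes, width one and rounding\<close>

lemma compressed_imp_width_one:
  fixes S :: "(real^'m) set"
  assumes "finite (convex hull S \<inter> L)" "S \<subseteq> L" "compressed L (convex hull S)"
  shows "width_one S"
  unfolding width_one_def
proof (intro allI impI ballI)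
  fix a c p q
  let ?P = "convex hull S"
  let ?F = "?P \<inter> {x. a \<bullet> x = c}"
  assume le: "?P \<subseteq> {x. a \<bullet> x \<le> c}" and F: "?F facet_of ?P"
    and p: "p \<in> S" "a \<bullet> p \<noteq> c" and q: "q \<in> S" "a \<bullet> q \<noteq> c"
  define X where "X = ?P \<inter> L"
  have X: "S \<subseteq> X" "X \<subseteq> ?P" "finite X" using assms(1,2) hull_subset by (auto simp: X_def hull_inc)
  have conv: "convex hull X = ?P"
    using X by (intro antisym hull_minimal hull_mono) auto
  show "a \<bullet> p = a \<bullet> q"
  proof (cases "p = q")
    case False
    \<comment> \<open>Otherwise the polytope is a simplex, whose facets each miss just one vertex,
      while \<open>?F\<close> misses both \<open>p\<close> and \<open>q\<close>. Dependence sends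
      \<open>pulling\<close> into its recursive branch.\<close>
    have dep: "affine_dependent X"
    proof (rule ccontr)
      assume "\<not> affine_dependent X"
      then obtain u where u: "u \<in> X" "?F = convex hull (X - {u})"
        using F conv facet_of_convex_hull_affine_independent[of X ?F] by auto
      have "x = u" if "x \<in> X" "a \<bullet> x \<noteq> c" for x
        using u that hull_inc[of x "X - {u}" convex] by auto
      then show False using False p q X(1) by blast
    qed
    obtain ys where ys: "set ys = X - {p, q}" "distinct ys"
      using finite_distinct_list[of "X - {p, q}"] X(3) by auto
    let ?zs = "filter (\<lambda>x. x \<in> ?F) ys"
    obtain \<rho> where \<rho>: "\<rho> \<in> pulling ?zs" using pulling_nonempty by blast
    have "set ?zs \<subseteq> ?F" by auto
    then have \<rho>F: "\<rho> \<subseteq> ?F" using pulling_subset[OF \<rho>] by (rule order_trans[rotated])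
    have pull: "is_arg_min (\<lambda>\<tau>. rel_volume (convex hull \<tau>)) (lattice_simplex L ?P) (insert u \<rho>)"
      if u: "u \<in> X" "v \<in> X" "u \<noteq> v" "a \<bullet> u \<noteq> c" "a \<bullet> v \<noteq> c" "{u, v} = {p, q}" for u v
    proof -
      have set: "set (u # v # ys) = X" using ys u by auto
      have eq: "pulling (u # v # ys) = (\<Union>F\<in>{F. F facet_of convex hull X \<and> u \<notin> F}.
          insert u ` pulling (filter (\<lambda>x. x \<in> F) (u # v # ys)))"
        by (subst pulling.simps) (simp only: set list.sel dep not_True_eq_False if_False)
      \<comment> \<open>As \<open>u\<close> and \<open>v\<close> both lie off the facet, the list
        passed to the recursion is the same whichever of them is pulled first; this gives both
        pyramids the same base \<open>\<rho>\<close>.\<close>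
      have "filter (\<lambda>x. x \<in> ?F) (u # v # ys) = ?zs" using u by simp
      then have "insert u \<rho> \<in> insert u ` pulling (filter (\<lambda>x. x \<in> ?F) (u # v # ys))"
        using \<rho> by simp
      moreover have "?F \<in> {F. F facet_of convex hull X \<and> u \<notin> F}" using F conv u by simp
      ultimately have "insert u \<rho> \<in> pulling (u # v # ys)" unfolding eq by (rule UN_I[rotated])
      moreover have "distinct (u # v # ys)" using ys u by auto
      ultimately show ?thesis
        using assms(3) set unfolding compressed_def X_def by blast
    qed
    have min: "is_arg_min (\<lambda>\<tau>. rel_volume (convex hull \<tau>)) (lattice_simplex L ?P) (insert p \<rho>)"
      "is_arg_min (\<lambda>\<tau>. rel_volume (convex hull \<tau>)) (lattice_simplex L ?P) (insert q \<rho>)"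
      using pull[of p q] pull[of q p] False p q X(1) by auto
    \<comment> \<open>Both pyramids minimise the volume over the same family of lattice
      simplices.\<close>
    then have vol: "rel_volume (convex hull (insert p \<rho>)) = rel_volume (convex hull (insert q \<rho>))"
      unfolding is_arg_min_def by (meson linorder_neqE_linordered_idom)
    have simplex: "lattice_simplex L ?P (insert p \<rho>)" "lattice_simplex L ?P (insert q \<rho>)"
      using min by (auto simp: is_arg_min_def)
    then have indep: "\<not> affine_dependent (insert p \<rho>)"
      and hull: "affine hull (insert q \<rho>) = affine hull (insert p \<rho>)"
      using aff_dim_eq_full_gen[of "insert p \<rho>" ?P] aff_dim_eq_full_gen[of "insert q \<rho>" ?P]
      by (auto simp: lattice_simplex_def)
    have "\<rho> \<noteq> {}"
    proof
      assume "\<rho> = {}"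
      then have "{q} = {p}" using hull by simp
      then show False using False by simp
    qed
    then have "\<bar>a \<bullet> q - c\<bar> * rel_volume (convex hull (insert p \<rho>))
        = \<bar>a \<bullet> p - c\<bar> * rel_volume (convex hull (insert p \<rho>))"
      using pyramid_volume_ratio[OF indep hull, of a c] \<rho>F p(2) vol by auto
    moreover have "0 < rel_volume (convex hull (insert p \<rho>))"
      using aff_independent_finite[OF indep]
      by (intro rel_volume_pos) (auto simp: finite_imp_compact_convex_hull)
    ultimately have "\<bar>a \<bullet> q - c\<bar> = \<bar>a \<bullet> p - c\<bar>" by simp
    moreover have "a \<bullet> q \<le> c" "a \<bullet> p \<le> c"
      using le hull_inc[OF q(1), of convex] hull_inc[OF p(1), of convex] by auto
    ultimately show ?thesis by simp
  qed simp
qed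

text \<open>Since the lattice points of the polytope are exactly \<open>S\<close>, every ordering
  lists \<open>S\<close>, and each pulled simplex generates the whole lattice; no other lattice
  simplex can then have smaller volume.\<close>

lemma rounding_imp_compressed:
  fixes S :: "(real^'m) set"
  assumes "rounding S" and w: "\<And>s. s \<in> S \<Longrightarrow> w \<bullet> s = 1"
  shows "compressed (group_closure S) (convex hull S)"
  unfolding compressed_def
proof (intro allI impI ballI)
  let ?P = "convex hull S" and ?L = "group_closure S"
  fix xs \<sigma>
  assume xs: "distinct xs \<and> set xs = ?P \<inter> ?L" and \<sigma>: "\<sigma> \<in> pulling xs"
  have S: "?P \<inter> ?L = S" using rounding_lattice_points[OF assms] .
  then have set: "set xs = S" using xs by simp
  have \<sigma>': "\<not> affine_dependent \<sigma>" "affine hull \<sigma> = affine hull S" "S \<subseteq> group_closure \<sigma>"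
    using rounding_pulling[of xs w \<sigma>] assms \<sigma> unfolding set by auto
  have "\<sigma> \<subseteq> S" using pulling_subset[OF \<sigma>] set by simp
  have "aff_dim \<sigma> = aff_dim ?P"
    using \<sigma>'(2) by (metis aff_dim_affine_hull aff_dim_convex_hull)
  then have "lattice_simplex ?L ?P \<sigma>"
    using \<sigma>'(1) \<open>\<sigma> \<subseteq> S\<close> S by (simp add: lattice_simplex_def)
  moreover have "rel_volume (convex hull \<sigma>) \<le> rel_volume (convex hull \<tau>)"
    if "lattice_simplex ?L ?P \<tau>" for \<tau>
  proof (rule lattice_simplex_volume_le)
    have \<tau>: "\<tau> \<subseteq> S" "\<not> affine_dependent \<tau>" "aff_dim \<tau> = aff_dim ?P"
      using that S by (auto simp: lattice_simplex_def)
    show "\<not> affine_dependent \<tau>" by fact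
    show "\<not> affine_dependent \<sigma>" by fact
    show "affine hull \<tau> = affine hull \<sigma>"
      using \<tau> \<sigma>'(2) aff_dim_eq_full_gen[of \<tau> S] by (simp add: aff_dim_convex_hull)
    show "\<tau> \<subseteq> group_closure \<sigma>" using \<tau>(1) \<sigma>'(3) by blast
    show "w \<bullet> s = 1" if "s \<in> \<sigma> \<union> \<tau>" for s using that \<tau>(1) \<open>\<sigma> \<subseteq> S\<close> w by blast
  qed
  ultimately show "is_arg_min (\<lambda>\<tau>. rel_volume (convex hull \<tau>)) (lattice_simplex ?L ?P) \<sigma>"
    unfolding is_arg_min_def by (meson not_less)
qed

theorem theorem4p3:
  fixes A :: "real^'n^'m"
  assumes integral: "\<And>k j. A $ k $ j \<in> \<int>"
    and homogeneous: "\<exists>w. w \<noteq> 0 \<and> (\<forall>j. w \<bullet> column j A = 1)"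
  shows "(\<forall>i b. IP_feasible A b \<longrightarrow> LP_max i A b = IP_max i A b) \<longleftrightarrow>
         compressed (group_closure (columns A)) (convex hull (columns A))"
proof -
  obtain w where "\<forall>j. w \<bullet> column j A = 1" using homogeneous by blast
  then have w: "w \<bullet> s = 1" if "s \<in> columns A" for s using that by (auto simp: columns_def)
  have fin: "finite (columns A)" by (simp add: columns_def full_SetCompr_eq)
  have "v $ k \<in> \<int>" if "v \<in> columns A" for v k
    using that integral by (auto simp: columns_def column_def)
  moreover have "bounded (convex hull (columns A))"
    using fin by (simp add: finite_imp_bounded_convex_hull)
  \<comment> \<open>Finiteness guarantees that the lattice points can be listed, so that
    \<open>compressed\<close> does not hold vacuously.\<close>
  ultimately have "finite (convex hull (columns A) \<inter> group_closure (columns A))"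
    by (rule finite_lattice_points)
  then have "width_one (columns A)"
    if "compressed (group_closure (columns A)) (convex hull (columns A))"
    using compressed_imp_width_one that by (auto intro: group_closure.base)
  then show ?thesis
    unfolding LP_eq_IP_iff_rounding
    using width_one_imp_rounding[OF fin w] rounding_imp_compressed[OF _ w] by blast
qed

end
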